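(* Let $\psi\in\mathcal{O}_M(\mathbb{R})$ be a real-valued function such that $\psi:\mathbb{R}\to\mathbb{R}$ is bijective and such that $\psi(x)>x$ as well as $\psi'(x)>0$ for every $x\in\mathbb{R}$. Additionally, assume that $$\forall\,j\in\mathbb{N}\ \exists\,\beta_j\in\mathbb{R},\ C_j>0,\ t_j\in\mathbb{N}\ \forall\,x\in (\beta_j,\infty),\ n\in\mathbb{N}:\ |(\psi_{-n})^{(j)}(x)|\leq C_j(1+|x|^2)^{t_j}$$ and $$\forall\,j\in\mathbb{N}\ \exists\,\alpha_j\in\mathbb{R},\ C_j>0,\ t_j\in\mathbb{N}\ \forall\,x\in (-\infty,\alpha_j),\ n\in\mathbb{N}:\ |(\psi_n)^{(j)}(x)|\leq C_j(1+|x|^2)^{t_j}.$$ Then $C_{\psi}:\mathcal{O}_M(\mathbb{R})\rightarrow\mathcal{O}_M(\mathbb{R})$, $f\mapsto f\circ\psi$, is sequentially hypercyclic.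
   Context: $\mathbb{N}=\{1,2,3,\ldots\}$, $\mathbb{N}_0=\mathbb{N}\cup\{0\}$. $\mathcal{S}(\mathbb{R})$ is the Schwartz space of rapidly decreasing smooth functions. For $m,n\in\mathbb{N}$ let $\mathcal{O}_n^m(\mathbb{R})=\{f\in C^m(\mathbb{R}): |f|_{m,n}:=\sup_{x\in\mathbb{R},\,0\le j\le m}(1+|x|^2)^{-n}|f^{(j)}(x)|<\infty\}$, a Banach space under $|\cdot|_{m,n}$, and $\mathcal{O}_M(\mathbb{R})=\bigcap_{m=1}^\infty\bigcup_{n=1}^\infty\mathcal{O}_n^m(\mathbb{R})$ (slowly increasing smooth functions, the multipliers of $\mathcal{S}(\mathbb{R})$). It carries the locally convex topology of the projective limit over $m$ of the (LB)-spaces $\operatorname{ind}_{n\to\infty}\mathcal{O}_n^m(\mathbb{R})$; equivalently, the topology given by the seminorms $p_{m,v}(f)=\sup_{x\in\mathbb{R}}\max_{0\le j\le m}|v(x)f^{(j)}(x)|$, $m\ge 0$, $v\in\mathcal{S}(\mathbb{R})$. For a smooth $\psi:\mathbb{R}\to\mathbb{R}$, the operator $C_\psi$ is well defined (and then continuous) on $\mathcal{O}_M(\mathbb{R})$ if and only if $\psi\in\mathcal{O}_M(\mathbb{R})$. Iterates: $\psi_0(x)=x$, $\psi_n=\psi\circ\psi_{n-1}$ for $n\in\mathbb{N}$; for bijective $\psi$ and $n\in\mathbb{N}$, $\psi_{-n}$ is the inverse of $\psi_n$. A continuous linear operator $T$ on a topological vector space $E$ is sequentially hypercyclic if there is $x\in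 E$ whose orbit $\{T^nx: n\in\mathbb{N}_0\}$ is sequentially dense in $E$, i.e. every element of $E$ is the limit of a sequence of elements of the orbit. *)

theory Defs
  imports "HOL-Analysis.Analysis"
begin

definition nth_deriv :: "nat \<Rightarrow> (real \<Rightarrow> 'a::real_normed_vector) \<Rightarrow> real \<Rightarrow> 'a" where
  "nth_deriv j f = ((\<lambda>g x. vector_derivative g (at x)) ^^ j) f"

definition Cm :: "nat \<Rightarrow> (real \<Rightarrow> 'a::real_normed_vector) set" where
  "Cm m = {f. (\<forall>j<m. \<forall>x. nth_deriv j f differentiable (at x)) \<and>
              continuous_on UNIV (nth_deriv m f)}"

definition Omn_norm :: "nat \<Rightarrow> nat \<Rightarrow> (real \<Rightarrow> 'a::real_normed_vector) \<Rightarrow> real" where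
  "Omn_norm m n f = (SUP (x, j)\<in>UNIV \<times> {0..m}. norm (nth_deriv j f x) / (1 + \<bar>x\<bar>\<^sup>2) ^ n)"

definition Omn :: "nat \<Rightarrow> nat \<Rightarrow> (real \<Rightarrow> 'a::real_normed_vector) set" where
  "Omn m n = {f \<in> Cm m.
     bdd_above ((\<lambda>(x, j). norm (nth_deriv j f x) / (1 + \<bar>x\<bar>\<^sup>2) ^ n) ` (UNIV \<times> {0..m}))}"

definition Om :: "nat \<Rightarrow> (real \<Rightarrow> 'a::real_normed_vector) set" where
  "Om m = (\<Union>n\<in>{1..}. Omn m n)"

definition OM :: "(real \<Rightarrow> 'a::real_normed_vector) set" where
  "OM = (\<Inter>m\<in>{1..}. Om m)"

text \<open>Function types carry no vector space class structure, so the pointwise vector operations are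
  written out. The topologies below live on spaces of complex-valued functions over complex
  scalars.\<close>

definition absolutely_convex :: "('a \<Rightarrow> complex) set \<Rightarrow> bool" where
  "absolutely_convex V \<longleftrightarrow> V \<noteq> {} \<and>
     (\<forall>f\<in>V. \<forall>g\<in>V. \<forall>a b. norm a + norm b \<le> 1 \<longrightarrow> (\<lambda>x. a * f x + b * g x) \<in> V)"

text \<open>The basic zero neighbourhoods of the locally convex inductive limit of the Banach spaces
  \<open>Omn m n\<close> over \<open>n\<close>: absolutely convex sets whose trace on every step is a
  neighbourhood of zero there.\<close>

definition Om_zero_nhd :: "nat \<Rightarrow> (real \<Rightarrow> complex) set \<Rightarrow> bool" where
  "Om_zero_nhd m V \<longleftrightarrow> V \<subseteq> Om m \<and> absolutely_convex V \<and>
     (\<forall>n\<ge>1. \<exists>e>0. \<forall>h\<in>Omn m n. Omn_norm m n h < e \<longrightarrow> h \<in> V)"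

definition Om_topology :: "nat \<Rightarrow> (real \<Rightarrow> complex) topology" where
  "Om_topology m = topology (\<lambda>U. U \<subseteq> Om m \<and>
     (\<forall>f\<in>U. \<exists>V. Om_zero_nhd m V \<and> (\<forall>h\<in>V. (\<lambda>x. f x + h x) \<in> U)))"

text \<open>Projective limit over \<open>m\<close>: the coarsest topology on \<open>OM\<close> for which all inclusions
  into the spaces \<open>Om m\<close> are continuous.\<close>

definition OM_topology :: "(real \<Rightarrow> complex) topology" where
  "OM_topology = topology_generated_by (\<Union>m\<in>{1..}. {U \<inter> OM | U. openin (Om_topology m) U})"

definition linear_op_on ::
  "('a \<Rightarrow> complex) set \<Rightarrow> (('a \<Rightarrow> complex) \<Rightarrow> ('a \<Rightarrow> complex)) \<Rightarrow> bool" where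
  "linear_op_on E T \<longleftrightarrow>
     (\<forall>f\<in>E. \<forall>g\<in>E. \<forall>a b. T (\<lambda>x. a * f x + b * g x) = (\<lambda>x. a * T f x + b * T g x))"

definition sequentially_hypercyclic ::
  "('a \<Rightarrow> complex) topology \<Rightarrow> (('a \<Rightarrow> complex) \<Rightarrow> ('a \<Rightarrow> complex)) \<Rightarrow> bool" where
  "sequentially_hypercyclic X T \<longleftrightarrow>
     continuous_map X X T \<and> linear_op_on (topspace X) T \<and>
     (\<exists>f\<in>topspace X. \<forall>g\<in>topspace X. \<exists>s :: nat \<Rightarrow> 'a \<Rightarrow> complex.
        range s \<subseteq> range (\<lambda>n. (T ^^ n) f) \<and> limitin X s g sequentially)"

definition comp_op :: "('a \<Rightarrow> 'a) \<Rightarrow> ('a \<Rightarrow> 'b) \<Rightarrow> 'a \<Rightarrow> 'b" where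
  "comp_op \<psi> f = f \<circ> \<psi>"


lemma istopology_Om:
  "istopology (\<lambda>U. U \<subseteq> Om m \<and>
     (\<forall>f\<in>U. \<exists>V. Om_zero_nhd m V \<and> (\<forall>h\<in>V. (\<lambda>x. f x + h x) \<in> U)))"
proof -
  have int: "Om_zero_nhd m (V \<inter> W)" if V: "Om_zero_nhd m V" and W: "Om_zero_nhd m W" for V W
  proof -
    have zero: "(\<lambda>x. 0) \<in> Z" if "Om_zero_nhd m Z" for Z
    proof -
      have ac: "absolutely_convex Z" using that by (simp add: Om_zero_nhd_def)
      then obtain f where "f \<in> Z" by (auto simp: absolutely_convex_def)
      moreover have "norm (0::complex) + norm (0::complex) \<le> 1" by simp
      ultimately have "(\<lambda>x. 0 * f x + 0 * f x) \<in> Z"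
        using ac unfolding absolutely_convex_def by blast
      then show ?thesis by simp
    qed
    have ac: "absolutely_convex (V \<inter> W)"
      unfolding absolutely_convex_def
    proof (intro conjI ballI allI impI)
      show "V \<inter> W \<noteq> {}" using zero[OF V] zero[OF W] by blast
    next
      fix f g and a b :: complex
      assume fg: "f \<in> V \<inter> W" "g \<in> V \<inter> W" and ab: "norm a + norm b \<le> 1"
      have "absolutely_convex V" "absolutely_convex W"
        using V W by (simp_all add: Om_zero_nhd_def)
      then show "(\<lambda>x. a * f x + b * g x) \<in> V \<inter> W"
        using fg ab by (simp add: absolutely_convex_def)
    qed
    have "\<exists>e>0. \<forall>h\<in>Omn m n. Omn_norm m n h < e \<longrightarrow> h \<in> V \<inter> W" if "n \<ge> 1" for n
    proof -
      obtain d where "d > 0" "\<forall>h\<in>Omn m n. Omn_norm m n h < d \<longrightarrow> h \<in> V"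
        using V \<open>n \<ge> 1\<close> unfolding Om_zero_nhd_def by blast
      moreover obtain e where "e > 0" "\<forall>h\<in>Omn m n. Omn_norm m n h < e \<longrightarrow> h \<in> W"
        using W \<open>n \<ge> 1\<close> unfolding Om_zero_nhd_def by blast
      ultimately show ?thesis by (intro exI[of _ "min d e"]) auto
    qed
    then show ?thesis using V ac unfolding Om_zero_nhd_def by blast
  qed
  show ?thesis
    unfolding istopology_def
  proof (intro conjI allI impI ballI)
    fix S T f
    assume S: "S \<subseteq> Om m \<and> (\<forall>f\<in>S. \<exists>V. Om_zero_nhd m V \<and> (\<forall>h\<in>V. (\<lambda>x. f x + h x) \<in> S))"
      and T: "T \<subseteq> Om m \<and> (\<forall>f\<in>T. \<exists>V. Om_zero_nhd m V \<and> (\<forall>h\<in>V. (\<lambda>x. f x + h x) \<in> T))"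
      and f: "f \<in> S \<inter> T"
    obtain V where V: "Om_zero_nhd m V" "\<forall>h\<in>V. (\<lambda>x. f x + h x) \<in> S" using S f by blast
    obtain W where W: "Om_zero_nhd m W" "\<forall>h\<in>W. (\<lambda>x. f x + h x) \<in> T" using T f by blast
    show "\<exists>V. Om_zero_nhd m V \<and> (\<forall>h\<in>V. (\<lambda>x. f x + h x) \<in> S \<inter> T)"
      using int[OF V(1) W(1)] V(2) W(2) by blast
  next
    fix K
    assume "\<forall>S\<in>K. S \<subseteq> Om m \<and>
      (\<forall>f\<in>S. \<exists>V. Om_zero_nhd m V \<and> (\<forall>h\<in>V. (\<lambda>x. f x + h x) \<in> S))"
    then show "\<Union>K \<subseteq> Om m" by blast
  next
    fix K f
    assume K: "\<forall>S\<in>K. S \<subseteq> Om m \<and>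
        (\<forall>f\<in>S. \<exists>V. Om_zero_nhd m V \<and> (\<forall>h\<in>V. (\<lambda>x. f x + h x) \<in> S))"
      and "f \<in> \<Union>K"
    then obtain S where "S \<in> K" "f \<in> S" by blast
    with K obtain V where "Om_zero_nhd m V" "\<forall>h\<in>V. (\<lambda>x. f x + h x) \<in> S" by blast
    with \<open>S \<in> K\<close> show "\<exists>V. Om_zero_nhd m V \<and> (\<forall>h\<in>V. (\<lambda>x. f x + h x) \<in> \<Union>K)"
      by blast
  qed blast
qed

lemma openin_Om_topology:
  "openin (Om_topology m) U \<longleftrightarrow> U \<subseteq> Om m \<and>
     (\<forall>f\<in>U. \<exists>V. Om_zero_nhd m V \<and> (\<forall>h\<in>V. (\<lambda>x. f x + h x) \<in> U))"
  by (simp add: Om_topology_def topology_inverse'[OF istopology_Om])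

lemma nth_deriv_Suc: "nth_deriv (Suc j) f x = vector_derivative (nth_deriv j f) (at x)"
  by (simp add: nth_deriv_def)

lemma nth_deriv_lincomb:
  fixes f g :: "real \<Rightarrow> complex"
  assumes "f \<in> Cm m" "g \<in> Cm m" "j \<le> m"
  shows "nth_deriv j (\<lambda>x. a * f x + b * g x) = (\<lambda>x. a * nth_deriv j f x + b * nth_deriv j g x)"
  using \<open>j \<le> m\<close>
proof (induction j)
  case 0
  then show ?case by (simp add: nth_deriv_def)
next
  case (Suc j)
  show ?case
  proof
    fix x
    have d: "nth_deriv j f differentiable (at x)" "nth_deriv j g differentiable (at x)"
      using assms Suc.prems by (auto simp: Cm_def)
    then have "((\<lambda>x. a * nth_deriv j f x + b * nth_deriv j g x) has_vector_derivative
        (a * nth_deriv (Suc j) f x + b * nth_deriv (Suc j) g x)) (at x)"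
      unfolding nth_deriv_Suc vector_derivative_works
      by (intro has_vector_derivative_add has_vector_derivative_mult_right)
    then show "nth_deriv (Suc j) (\<lambda>x. a * f x + b * g x) x =
        a * nth_deriv (Suc j) f x + b * nth_deriv (Suc j) g x"
      using Suc by (subst nth_deriv_Suc) (simp add: vector_derivative_at)
  qed
qed

lemma Cm_lincomb:
  fixes f g :: "real \<Rightarrow> complex"
  assumes "f \<in> Cm m" "g \<in> Cm m"
  shows "(\<lambda>x. a * f x + b * g x) \<in> Cm m"
proof -
  have "nth_deriv j (\<lambda>x. a * f x + b * g x) differentiable (at x)" if "j < m" for j x
    using assms that
    by (subst nth_deriv_lincomb[OF assms]) (auto simp: Cm_def intro!: derivative_intros)
  moreover have "continuous_on UNIV (nth_deriv m (\<lambda>x. a * f x + b * g x))"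
    using assms
    by (subst nth_deriv_lincomb[OF assms]) (auto simp: Cm_def intro!: continuous_intros)
  ultimately show ?thesis by (simp add: Cm_def)
qed

lemma Omn_iff:
  "f \<in> Omn m n \<longleftrightarrow>
     f \<in> Cm m \<and> (\<exists>C. \<forall>x. \<forall>j\<le>m. norm (nth_deriv j f x) \<le> C * (1 + \<bar>x\<bar>\<^sup>2) ^ n)"
proof -
  have "(0::real) < (1 + x\<^sup>2) ^ n" for x :: real
    by (intro zero_less_power add_pos_nonneg) auto
  then have le: "norm (nth_deriv j f x) / (1 + x\<^sup>2) ^ n \<le> C \<longleftrightarrow>
      norm (nth_deriv j f x) \<le> C * (1 + x\<^sup>2) ^ n" for j x C
    by (rule pos_divide_le_eq)
  show ?thesis
    unfolding Omn_def bdd_above_def by (simp add: le atLeast0AtMost atMost_def)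
qed

lemma Om_lincomb:
  fixes f g :: "real \<Rightarrow> complex"
  assumes "f \<in> Om m" "g \<in> Om m"
  shows "(\<lambda>x. a * f x + b * g x) \<in> Om m"
proof -
  obtain p C where p: "p \<ge> 1" and f: "f \<in> Cm m"
    and C: "\<And>x j. j \<le> m \<Longrightarrow> norm (nth_deriv j f x) \<le> C * (1 + \<bar>x\<bar>\<^sup>2) ^ p"
    using assms(1) by (auto simp: Om_def Omn_iff)
  obtain q D where q: "q \<ge> 1" and g: "g \<in> Cm m"
    and D: "\<And>x j. j \<le> m \<Longrightarrow> norm (nth_deriv j g x) \<le> D * (1 + \<bar>x\<bar>\<^sup>2) ^ q"
    using assms(2) by (auto simp: Om_def Omn_iff)
  have "C \<ge> 0" using order_trans[OF norm_ge_zero C[of 0 0]] by simp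
  have "D \<ge> 0" using order_trans[OF norm_ge_zero D[of 0 0]] by simp
  have "norm (nth_deriv j (\<lambda>x. a * f x + b * g x) x)
      \<le> (norm a * C + norm b * D) * (1 + \<bar>x\<bar>\<^sup>2) ^ (p + q)" if "j \<le> m" for x j
  proof -
    let ?w = "1 + \<bar>x\<bar>\<^sup>2"
    have w: "?w ^ p \<le> ?w ^ (p + q)" "?w ^ q \<le> ?w ^ (p + q)"
      by (intro power_increasing; simp)+
    have "norm (nth_deriv j f x) \<le> C * ?w ^ (p + q)" "norm (nth_deriv j g x) \<le> D * ?w ^ (p + q)"
      using order_trans[OF C[OF that] mult_left_mono[OF w(1) \<open>C \<ge> 0\<close>]]
        order_trans[OF D[OF that] mult_left_mono[OF w(2) \<open>D \<ge> 0\<close>]] by blast+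
    then have "norm a * norm (nth_deriv j f x) + norm b * norm (nth_deriv j g x)
        \<le> norm a * (C * ?w ^ (p + q)) + norm b * (D * ?w ^ (p + q))"
      by (intro add_mono mult_left_mono) auto
    moreover have "norm (a * nth_deriv j f x + b * nth_deriv j g x)
        \<le> norm a * norm (nth_deriv j f x) + norm b * norm (nth_deriv j g x)"
      by (metis norm_mult norm_triangle_ineq)
    ultimately show ?thesis
      using nth_deriv_lincomb[OF f g that] by (simp add: algebra_simps)
  qed
  then have "(\<lambda>x. a * f x + b * g x) \<in> Omn m (p + q)"
    unfolding Omn_iff using Cm_lincomb[OF f g] by blast
  then show ?thesis unfolding Om_def using p by auto
qed

lemma nth_deriv_zero: "nth_deriv j (\<lambda>x. 0) = (\<lambda>x. 0)"
  by (induction j) (auto simp: nth_deriv_def)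

lemma zero_in_Om: "(\<lambda>x. 0) \<in> Om m"
  by (auto simp: Om_def Omn_iff Cm_def nth_deriv_zero intro!: bexI[of _ 1] exI[of _ 0])

lemma topspace_Om_topology: "topspace (Om_topology m) = Om m"
proof -
  have ne: "(Om m :: (real \<Rightarrow> complex) set) \<noteq> {}" using zero_in_Om by blast
  have "absolutely_convex (Om m)"
    using Om_lincomb ne by (auto simp: absolutely_convex_def)
  moreover have "Omn m n \<subseteq> (Om m :: (real \<Rightarrow> complex) set)" if "n \<ge> 1" for n
    using that by (auto simp: Om_def)
  ultimately have "Om_zero_nhd m (Om m)"
    unfolding Om_zero_nhd_def by (auto intro!: exI[of _ "1::real"])
  moreover have "(\<lambda>x. f x + h x) \<in> Om m" if "f \<in> Om m" "h \<in> Om m" for f h :: "real \<Rightarrow> complex"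
    using Om_lincomb[OF that, of 1 1] by simp
  ultimately have "openin (Om_topology m) (Om m)"
    unfolding openin_Om_topology by blast
  moreover have "topspace (Om_topology m) \<subseteq> Om m"
    using openin_topspace[of "Om_topology m"] openin_Om_topology by blast
  ultimately show ?thesis
    by (intro subset_antisym openin_subset)
qed

lemma topspace_OM_topology: "topspace OM_topology = OM"
proof -
  have "OM = Om 1 \<inter> OM" by (auto simp: OM_def)
  moreover have "openin (Om_topology 1) (Om 1)"
    using openin_topspace[of "Om_topology 1"] by (simp add: topspace_Om_topology)
  ultimately have "OM \<in> (\<Union>m\<in>{1..}. {U \<inter> OM | U. openin (Om_topology m) U})" by auto
  then show ?thesis unfolding OM_topology_def by (auto simp: topology_generated_by_topspace)
qed

end

theory Submission
  imports Defs
begin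

text \<open>
  Fix a sequence \<open>g\<^sub>k\<close> of compactly supported smooth functions that is sequentially dense in \<open>OM\<close> and
  put \<open>f = (\<Sum>l. g\<^sub>l \<circ> \<psi>^(-\<nu>(l)))\<close>. Since \<open>\<psi>\<close> is increasing with \<open>\<psi>(x) > x\<close>, its iterates push every compact set to
  \<open>+\<infinity>\<close>, so for rapidly increasing exponents \<open>\<nu>(l)\<close> the summands have disjoint supports. Then
  \<open>f \<circ> \<psi>^\<nu>(k)\<close> is \<open>g\<^sub>k\<close> plus terms \<open>g\<^sub>l \<circ> \<psi>^(-d)\<close> with \<open>l > k\<close> living far to the right and terms
  \<open>g\<^sub>l \<circ> \<psi>^d\<close> with \<open>l < k\<close> living far to the left, where the hypotheses bound all derivatives of
  \<open>\<psi>^(-d)\<close> and \<open>\<psi>^d\<close> polynomially and uniformly in \<open>d\<close>. The norms of the \<open>g\<^sub>l\<close> are dominated by the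
  distance of these supports to the origin, so a higher power of the weight makes the error small:
  \<open>f \<circ> \<psi>^\<nu>(k) - g\<^sub>k\<close> tends to zero in every \<open>Om m\<close>, in one fixed step \<open>Omn m n\<close>.
\<close>

section \<open>Calculus of repeatedly differentiable functions\<close>

text \<open>The target space is not metrizable, so a category argument for dense orbits does not by
  itself yield approximating sequences; the vector is built by hand. The obstacle is the order of
  choices: the constants \<beta>, \<open>C\<close>, \<open>t\<close> from the hypotheses depend on
  the order \<open>m\<close> of differentiation, while the exponents \<nu> must serve all
  \<open>m\<close> at once. So \<nu> is chosen from the functions \<open>g k\<close> alone: a number
  \<open>R k\<close> dominates \<open>k + 1\<close>, the support of \<open>g k\<close> and all
  derivatives up to order \<open>k\<close> of the functions of index at most \<open>k\<close>, and
  \<open>N k\<close> is a time after which the flow has carried \<open>- R k\<close> beyond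
  \<open>R k\<close>. For fixed \<open>m\<close>, the inequalities m <= k and \<beta> <= R k hold
  from some index on; what comes before is left to compactness. The single relation R k < \<psi>^d(-
  R k) serves both ends: it keeps \<open>g k\<close> composed with \<psi>^(-d) to the right of
  \<open>R k\<close>, and earlier functions composed with \<psi>^d to the left of
  \<open>- R k\<close>, exactly where the two hypotheses apply.\<close>

lemma nth_deriv_0 [simp]: "nth_deriv 0 f = f"
  by (simp add: nth_deriv_def)

text \<open>The definition peels off the outermost derivative. Inductions that generalise over the
  function need the innermost one, so that a rule for the first derivative can be used before the
  induction hypothesis.\<close>

lemma nth_deriv_Suc_shift: "nth_deriv (Suc j) f = nth_deriv j (\<lambda>x. vector_derivative f (at x))"
  using funpow_swap1[of "\<lambda>g x. vector_derivative g (at x)" j f] by (simp add: nth_deriv_def)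

lemma nth_deriv_Suc_eq:
  assumes "\<And>x. (f has_vector_derivative f' x) (at x)"
  shows "nth_deriv (Suc j) f = nth_deriv j f'"
proof -
  have "(\<lambda>x. vector_derivative f (at x)) = f'"
    using assms by (auto intro: vector_derivative_at)
  then show ?thesis by (simp add: nth_deriv_Suc_shift)
qed

lemma Cm_0 [simp]: "f \<in> Cm 0 \<longleftrightarrow> continuous_on UNIV f"
  by (simp add: Cm_def)

lemma Cm_Suc:
  "f \<in> Cm (Suc m) \<longleftrightarrow>
     (\<forall>x. f differentiable at x) \<and> (\<lambda>x. vector_derivative f (at x)) \<in> Cm m"
proof -
  have "(\<forall>j<Suc m. P j) \<longleftrightarrow> P 0 \<and> (\<forall>j<m. P (Suc j))" for P
    by (metis All_less_Suc2)
  then show ?thesis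
    unfolding Cm_def by (simp add: nth_deriv_Suc_shift)
qed

lemma Cm_SucI:
  assumes "\<And>x. (f has_vector_derivative f' x) (at x)" "f' \<in> Cm m"
  shows "f \<in> Cm (Suc m)"
proof -
  have "(\<lambda>x. vector_derivative f (at x)) = f'"
    using assms by (auto intro: vector_derivative_at)
  then show ?thesis
    using assms by (auto simp: Cm_Suc intro: differentiableI_vector)
qed

lemma Cm_SucE:
  assumes "f \<in> Cm (Suc m)"
  obtains f' where "\<And>x. (f has_vector_derivative f' x) (at x)" "f' \<in> Cm m"
    "\<And>j. nth_deriv (Suc j) f = nth_deriv j f'"
proof
  show "(f has_vector_derivative vector_derivative f (at x)) (at x)" for x
    using assms by (simp add: Cm_Suc vector_derivative_works)
  show "(\<lambda>x. vector_derivative f (at x)) \<in> Cm m"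
    using assms by (simp add: Cm_Suc)
qed (simp add: nth_deriv_Suc_shift)

lemma Cm_Suc_imp_Cm: "f \<in> Cm (Suc m) \<Longrightarrow> f \<in> Cm m"
  unfolding Cm_def
  by (auto intro!: continuous_at_imp_continuous_on differentiable_imp_continuous_within)

lemma Cm_mono: "f \<in> Cm m \<Longrightarrow> k \<le> m \<Longrightarrow> f \<in> Cm k"
  by (induction m) (auto simp: le_Suc_eq intro: Cm_Suc_imp_Cm)

lemma continuous_nth_deriv: "f \<in> Cm m \<Longrightarrow> j \<le> m \<Longrightarrow> continuous_on UNIV (nth_deriv j f)"
  using Cm_mono[of f m j] by (simp add: Cm_def)

lemma Cm_const: "(\<lambda>x. c) \<in> Cm m"
proof (induction m arbitrary: c)
  case (Suc m)
  show ?case by (rule Cm_SucI[where f' = "\<lambda>x. 0"]) (auto intro: Suc)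
qed simp

text \<open>Real-valued and general normed targets occur below, while
  \<open>nth_deriv_lincomb\<close> covers complex values. Smoothness and the derivative formula go
  through one induction on the order, with both functions replaced by their derivatives.\<close>

lemma Cm_add_nth_deriv_add:
  assumes "f \<in> Cm m" "g \<in> Cm m"
  shows "(\<lambda>x. f x + g x) \<in> Cm m \<and>
    (\<forall>j\<le>m. nth_deriv j (\<lambda>x. f x + g x) = (\<lambda>x. nth_deriv j f x + nth_deriv j g x))"
  using assms
proof (induction m arbitrary: f g)
  case 0
  then show ?case by (auto intro: continuous_on_add)
next
  case (Suc m)
  obtain f' where f': "\<And>x. (f has_vector_derivative f' x) (at x)" "f' \<in> Cm m"
    "\<And>j. nth_deriv (Suc j) f = nth_deriv j f'" using Suc.prems(1) by (rule Cm_SucE) blast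
  obtain g' where g': "\<And>x. (g has_vector_derivative g' x) (at x)" "g' \<in> Cm m"
    "\<And>j. nth_deriv (Suc j) g = nth_deriv j g'" using Suc.prems(2) by (rule Cm_SucE) blast
  have d: "((\<lambda>x. f x + g x) has_vector_derivative f' x + g' x) (at x)" for x
    using f'(1) g'(1) by (rule has_vector_derivative_add)
  have IH: "(\<lambda>x. f' x + g' x) \<in> Cm m"
    "\<And>j. j \<le> m \<Longrightarrow> nth_deriv j (\<lambda>x. f' x + g' x) = (\<lambda>x. nth_deriv j f' x + nth_deriv j g' x)"
    using Suc.IH[OF f'(2) g'(2)] by auto
  have "nth_deriv j (\<lambda>x. f x + g x) = (\<lambda>x. nth_deriv j f x + nth_deriv j g x)" if "j \<le> Suc m" for j
    using that IH(2) by (cases j) (auto simp: nth_deriv_Suc_eq[OF d] f'(3) g'(3))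
  then show ?case using Cm_SucI[OF d IH(1)] by blast
qed

lemma Cm_add: "f \<in> Cm m \<Longrightarrow> g \<in> Cm m \<Longrightarrow> (\<lambda>x. f x + g x) \<in> Cm m"
  using Cm_add_nth_deriv_add by blast

lemma nth_deriv_add:
  "f \<in> Cm m \<Longrightarrow> g \<in> Cm m \<Longrightarrow> j \<le> m \<Longrightarrow>
    nth_deriv j (\<lambda>x. f x + g x) x = nth_deriv j f x + nth_deriv j g x"
  using Cm_add_nth_deriv_add[of f m g] by auto

section \<open>Products and compositions\<close>

lemma Cm_scaleR:
  assumes "u \<in> Cm m" "f \<in> Cm m"
  shows "(\<lambda>x. u x *\<^sub>R f x) \<in> Cm m"
  using assms
proof (induction m arbitrary: u f)
  case 0
  then show ?case by (auto intro: continuous_on_scaleR)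
next
  case (Suc m)
  obtain u' where u': "\<And>x. (u has_vector_derivative u' x) (at x)" "u' \<in> Cm m"
    using Suc.prems(1) by (rule Cm_SucE) blast
  obtain f' where f': "\<And>x. (f has_vector_derivative f' x) (at x)" "f' \<in> Cm m"
    using Suc.prems(2) by (rule Cm_SucE) blast
  show ?case
  proof (rule Cm_SucI)
    show "((\<lambda>x. u x *\<^sub>R f x) has_vector_derivative u x *\<^sub>R f' x + u' x *\<^sub>R f x) (at x)" for x
      using u'(1) f'(1)
      by (intro has_vector_derivative_scaleR)
        (auto simp: has_real_derivative_iff_has_vector_derivative)
    show "(\<lambda>x. u x *\<^sub>R f' x + u' x *\<^sub>R f x) \<in> Cm m"
      using Suc.prems u'(2) f'(2) by (intro Cm_add Suc.IH) (auto intro: Cm_Suc_imp_Cm)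
  qed
qed

lemma Cm_mult: "u \<in> Cm m \<Longrightarrow> v \<in> Cm m \<Longrightarrow> (\<lambda>x. u x * v x :: real) \<in> Cm m"
  using Cm_scaleR[of u m v] by simp

text \<open>A substitute for the Leibniz formula: every differentiation doubles the number of
  products, each of which is at most \<open>A * B\<close>. This gives the factor
  \<open>2 ^ j\<close> without binomial coefficients.\<close>

lemma norm_nth_deriv_scaleR_le:
  assumes "u \<in> Cm m" "f \<in> Cm m" "j \<le> m"
    and "\<And>i. i \<le> j \<Longrightarrow> \<bar>nth_deriv i u x\<bar> \<le> A" "\<And>i. i \<le> j \<Longrightarrow> norm (nth_deriv i f x) \<le> B"
  shows "norm (nth_deriv j (\<lambda>x. u x *\<^sub>R f x) x) \<le> 2 ^ j * (A * B)"
  using assms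
proof (induction j arbitrary: u f m)
  case 0
  have "0 \<le> A" using 0(4)[of 0] by simp
  then show ?case using 0(4)[of 0] 0(5)[of 0] by (simp add: mult_mono)
next
  case (Suc j)
  then obtain m' where m: "m = Suc m'" by (cases m) auto
  obtain u' where u': "\<And>x. (u has_vector_derivative u' x) (at x)" "u' \<in> Cm m'"
    "\<And>j. nth_deriv (Suc j) u = nth_deriv j u'" using Suc.prems(1) m by (metis Cm_SucE)
  obtain f' where f': "\<And>x. (f has_vector_derivative f' x) (at x)" "f' \<in> Cm m'"
    "\<And>j. nth_deriv (Suc j) f = nth_deriv j f'" using Suc.prems(2) m by (metis Cm_SucE)
  have uf: "u \<in> Cm m'" "f \<in> Cm m'" using Suc.prems m by (auto intro: Cm_Suc_imp_Cm)
  have j: "j \<le> m'" using Suc.prems m by simp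
  have d: "((\<lambda>x. u x *\<^sub>R f x) has_vector_derivative u x *\<^sub>R f' x + u' x *\<^sub>R f x) (at x)" for x
    using u'(1) f'(1)
    by (intro has_vector_derivative_scaleR)
      (auto simp: has_real_derivative_iff_has_vector_derivative)
  have bu: "\<bar>nth_deriv i u' x\<bar> \<le> A" if "i \<le> j" for i
    using Suc.prems(4)[of "Suc i"] that by (simp add: u'(3))
  have bf: "norm (nth_deriv i f' x) \<le> B" if "i \<le> j" for i
    using Suc.prems(5)[of "Suc i"] that by (simp add: f'(3))
  have "nth_deriv (Suc j) (\<lambda>x. u x *\<^sub>R f x) x
      = nth_deriv j (\<lambda>x. u x *\<^sub>R f' x) x + nth_deriv j (\<lambda>x. u' x *\<^sub>R f x) x"
    unfolding nth_deriv_Suc_eq[OF d]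
    using uf u'(2) f'(2) j by (intro nth_deriv_add[of _ m'] Cm_scaleR)
  moreover have "norm (nth_deriv j (\<lambda>x. u x *\<^sub>R f' x) x) \<le> 2 ^ j * (A * B)"
    using Suc.prems(4) bf by (intro Suc.IH[OF uf(1) f'(2) j]) auto
  moreover have "norm (nth_deriv j (\<lambda>x. u' x *\<^sub>R f x) x) \<le> 2 ^ j * (A * B)"
    using Suc.prems(5) bu by (intro Suc.IH[OF u'(2) uf(2) j]) auto
  ultimately show ?case
    using norm_triangle_ineq[of "nth_deriv j (\<lambda>x. u x *\<^sub>R f' x) x" "nth_deriv j (\<lambda>x. u' x *\<^sub>R f x) x"]
    by simp
qed

lemma has_vector_derivative_comp:
  assumes "\<And>x. (f has_vector_derivative f' x) (at x)"
    and "\<And>x. (u has_vector_derivative u' x) (at x)"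
  shows "((f \<circ> u) has_vector_derivative u' x *\<^sub>R (f' \<circ> u) x) (at x)"
  using vector_diff_chain_at[OF assms(2) assms(1)] by simp

lemma Cm_comp:
  assumes "f \<in> Cm m" "u \<in> Cm m"
  shows "f \<circ> u \<in> Cm m"
  using assms
proof (induction m arbitrary: f)
  case 0
  then show ?case
    by (auto intro: continuous_on_compose continuous_on_subset simp del: o_apply)
next
  case (Suc m)
  obtain u' where u': "\<And>x. (u has_vector_derivative u' x) (at x)" "u' \<in> Cm m"
    using Suc.prems(2) by (rule Cm_SucE) blast
  obtain f' where f': "\<And>x. (f has_vector_derivative f' x) (at x)" "f' \<in> Cm m"
    using Suc.prems(1) by (rule Cm_SucE) blast
  show ?case
    using Cm_SucI[OF has_vector_derivative_comp[OF f'(1) u'(1)]]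
      Cm_scaleR[OF u'(2) Suc.IH[OF f'(2)]] Suc.prems(2) Cm_Suc_imp_Cm by blast
qed

text \<open>A substitute for the formula of Faa di Bruno: differentiate once to get u' times f' o u,
  then combine the product estimate with induction on the order. The bound \<open>B\<close> concerns
  derivatives of \<open>u\<close> of order at least 1, so \<open>u\<close> itself may be large, and
  \<open>M\<close> is needed only at the point \<open>u x\<close>. With j = k + 1 the powers of 2
  fit because k + k * k <= j * j.\<close>

lemma norm_nth_deriv_comp_le:
  assumes "f \<in> Cm m" "u \<in> Cm m" "j \<le> m" "1 \<le> B"
    and "\<And>i. i \<le> j \<Longrightarrow> norm (nth_deriv i f (u x)) \<le> M"
    and "\<And>i. 1 \<le> i \<Longrightarrow> i \<le> j \<Longrightarrow> \<bar>nth_deriv i u x\<bar> \<le> B"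
  shows "norm (nth_deriv j (f \<circ> u) x) \<le> 2 ^ (j * j) * B ^ j * M"
  using assms
proof (induction j arbitrary: f m rule: less_induct)
  case (less j)
  have M: "0 \<le> M" using order_trans[OF norm_ge_zero less.prems(5)[of 0]] by simp
  show ?case
  proof (cases j)
    case 0
    then show ?thesis using less.prems(5)[of 0] by simp
  next
    case (Suc k)
    then obtain m' where m: "m = Suc m'" using less.prems(3) by (cases m) auto
    obtain u' where u': "\<And>x. (u has_vector_derivative u' x) (at x)" "u' \<in> Cm m'"
      "\<And>j. nth_deriv (Suc j) u = nth_deriv j u'" using less.prems(2) m by (metis Cm_SucE)
    obtain f' where f': "\<And>x. (f has_vector_derivative f' x) (at x)" "f' \<in> Cm m'"
      "\<And>j. nth_deriv (Suc j) f = nth_deriv j f'" using less.prems(1) m by (metis Cm_SucE)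
    have u: "u \<in> Cm m'" using less.prems(2) m by (auto intro: Cm_Suc_imp_Cm)
    have k: "k \<le> m'" using less.prems(3) m Suc by simp
    have "norm (nth_deriv i (f' \<circ> u) x) \<le> 2 ^ (k * k) * B ^ k * M" if "i \<le> k" for i
    proof -
      have "norm (nth_deriv i (f' \<circ> u) x) \<le> 2 ^ (i * i) * B ^ i * M"
      proof (rule less.IH[OF _ f'(2) u])
        show "norm (nth_deriv l f' (u x)) \<le> M" if "l \<le> i" for l
          using less.prems(5)[of "Suc l"] that \<open>i \<le> k\<close> Suc by (simp add: f'(3))
        show "\<bar>nth_deriv l u x\<bar> \<le> B" if "1 \<le> l" "l \<le> i" for l
          using less.prems(6) that \<open>i \<le> k\<close> Suc by simp
      qed (use \<open>i \<le> k\<close> k Suc less.prems(4) in auto)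
      also have "\<dots> \<le> 2 ^ (k * k) * B ^ k * M"
        using that less.prems(4) M
        by (intro mult_right_mono mult_mono power_increasing) (auto intro: mult_le_mono)
      finally show ?thesis .
    qed
    moreover have "\<bar>nth_deriv i u' x\<bar> \<le> B" if "i \<le> k" for i
      using less.prems(6)[of "Suc i"] that Suc by (simp add: u'(3))
    ultimately have "norm (nth_deriv k (\<lambda>x. u' x *\<^sub>R (f' \<circ> u) x) x)
        \<le> 2 ^ k * (B * (2 ^ (k * k) * B ^ k * M))"
      using u'(2) Cm_comp[OF f'(2) u] k by (intro norm_nth_deriv_scaleR_le[of _ m'])
    also have "\<dots> = 2 ^ (k + k * k) * B ^ j * M"
      by (simp add: Suc power_add)
    also have "\<dots> \<le> 2 ^ (j * j) * B ^ j * M"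
      using less.prems(4) M by (intro mult_right_mono power_increasing) (auto simp: Suc)
    finally show ?thesis
      unfolding Suc nth_deriv_Suc_eq[OF has_vector_derivative_comp[OF f'(1) u'(1)]] .
  qed
qed

section \<open>Reciprocals, inverse functions and locality\<close>

lemma Cm_id: "(\<lambda>x. x) \<in> Cm m"
proof (cases m)
  case (Suc k)
  then show ?thesis
    using Cm_SucI[of "\<lambda>x. x" "\<lambda>x. 1" k] by (auto intro: Cm_const)
qed (simp add: continuous_on_id)

lemma Cm_inverse:
  fixes u :: "real \<Rightarrow> real"
  assumes "u \<in> Cm m" "\<And>x. u x \<noteq> 0"
  shows "(\<lambda>x. inverse (u x)) \<in> Cm m"
  using assms
proof (induction m)
  case 0
  then show ?case by (auto intro: continuous_on_inverse)
next
  case (Suc m)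
  obtain u' where u': "\<And>x. (u has_vector_derivative u' x) (at x)" "u' \<in> Cm m"
    using Suc.prems(1) by (rule Cm_SucE) blast
  have IH: "(\<lambda>x. inverse (u x)) \<in> Cm m"
    using Suc Cm_Suc_imp_Cm by blast
  show ?case
  proof (rule Cm_SucI)
    show "((\<lambda>x. inverse (u x)) has_vector_derivative
        (-1) * (u' x * (inverse (u x) * inverse (u x)))) (at x)" for x
      using DERIV_inverse_fun[of u "u' x" x UNIV] u'(1) Suc.prems(2)[of x]
      by (simp add: has_real_derivative_iff_has_vector_derivative mult_ac)
    show "(\<lambda>x. (-1) * (u' x * (inverse (u x) * inverse (u x)))) \<in> Cm m"
      using u'(2) IH by (intro Cm_mult Cm_const)
  qed
qed

text \<open>Regularity is bootstrapped from (inv u)' = 1 / (u' o inv u): if \<open>inv u\<close> is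
  of class m and u' is as well, the right-hand side is of class m, hence \<open>inv u\<close> is of
  class m + 1.\<close>

lemma Cm_inv:
  fixes u :: "real \<Rightarrow> real"
  assumes "u \<in> Cm m" "bij u" "\<And>x. (u has_real_derivative u' x) (at x)" "\<And>x. u' x > 0"
  shows "inv u \<in> Cm m"
proof -
  have uinv: "u (inv u y) = y" "inv u (u y) = y" for y
    using assms(2) by (simp_all add: bij_is_surj surj_f_inv_f bij_is_inj)
  have cont: "isCont (inv u) y" for y
  proof -
    have "isCont (inv u) (u (inv u y))"
    proof (rule isCont_inverse_function[of 1 "inv u y" "inv u" u])
      show "inv u (u z) = z" for z by (rule uinv(2))
      show "isCont u z" for z using assms(3) by (rule DERIV_isCont)
    qed simp
    then show ?thesis by (simp add: uinv)
  qed
  have der: "(inv u has_vector_derivative inverse (u' (inv u y))) (at y)" for y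
    unfolding has_real_derivative_iff_has_vector_derivative[symmetric]
  proof (rule DERIV_inverse_function[of u _ "inv u" y "y - 1" "y + 1"])
    show "u' (inv u y) \<noteq> 0" using assms(4)[of "inv u y"] by simp
    show "u (inv u z) = z" for z by (rule uinv(1))
  qed (use assms(3) cont in auto)
  show ?thesis using assms(1)
  proof (induction m)
    case 0
    then show ?case using cont by (simp add: continuous_at_imp_continuous_on)
  next
    case (Suc m)
    obtain v where v: "\<And>x. (u has_vector_derivative v x) (at x)" "v \<in> Cm m"
      using Suc.prems by (rule Cm_SucE) blast
    have "v = u'"
      using assms(3) v(1) vector_derivative_at
      by (metis ext has_real_derivative_iff_has_vector_derivative)
    have "u' \<circ> inv u \<in> Cm m"
      using v(2) Suc \<open>v = u'\<close> Cm_Suc_imp_Cm by (intro Cm_comp) auto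
    then have "(\<lambda>y. inverse ((u' \<circ> inv u) y)) \<in> Cm m"
      by (rule Cm_inverse) (metis assms(4) o_apply less_irrefl)
    then show ?case
      using Cm_SucI[OF der] by (simp add: o_def)
  qed
qed

lemma nth_deriv_cong_open:
  assumes "open U" "x \<in> U" "\<And>y. y \<in> U \<Longrightarrow> f y = g y"
  shows "nth_deriv j f x = nth_deriv j g x"
  using assms(2)
proof (induction j arbitrary: x)
  case (Suc j)
  have "eventually (\<lambda>y. nth_deriv j f y = nth_deriv j g y) (nhds x)"
    using Suc assms(1) eventually_nhds by blast
  then show ?case
    unfolding nth_deriv_Suc
    by (intro vector_derivative_cong_eq) (auto simp: Suc)
qed (use assms in auto)

lemma nth_deriv_eq_0:
  assumes "open U" "x \<in> U" "\<And>y. y \<in> U \<Longrightarrow> f y = 0"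
  shows "nth_deriv j f x = 0"
  using nth_deriv_cong_open[of U x f "\<lambda>x. 0" j] assms by (simp add: nth_deriv_zero)

text \<open>Meant for the glued vector, which near every point coincides with a single smooth
  summand, although no global formula is at hand.\<close>

lemma Cm_locally:
  assumes "\<And>x. \<exists>U g. open U \<and> x \<in> U \<and> g \<in> Cm m \<and> (\<forall>y\<in>U. f y = g y)"
  shows "f \<in> Cm m"
proof -
  have "\<exists>U g. open U \<and> x \<in> U \<and> g \<in> Cm m \<and> (\<forall>y\<in>U. nth_deriv j f y = nth_deriv j g y)" for x j
    using assms[of x] nth_deriv_cong_open by metis
  note loc = this
  have "nth_deriv j f differentiable at x" if "j < m" for j x
  proof -
    obtain U g where U: "open U" "x \<in> U" "g \<in> Cm m" "\<forall>y\<in>U. nth_deriv j f y = nth_deriv j g y"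
      using loc[of x j] by blast
    then have "nth_deriv j g differentiable at x" using that by (simp add: Cm_def)
    then show ?thesis
      unfolding differentiable_def
      using U by (metis has_derivative_transform_within_open)
  qed
  moreover have "isCont (nth_deriv m f) x" for x
  proof -
    obtain U g where U: "open U" "x \<in> U" "g \<in> Cm m" "\<forall>y\<in>U. nth_deriv m f y = nth_deriv m g y"
      using loc[of x m] by blast
    then have "isCont (nth_deriv m g) x"
      by (simp add: Cm_def continuous_on_eq_continuous_at)
    moreover have "eventually (\<lambda>y. nth_deriv m f y = nth_deriv m g y) (nhds x)"
      using U eventually_nhds by blast
    ultimately show ?thesis using isCont_cong by blast
  qed
  ultimately show ?thesis by (simp add: Cm_def continuous_at_imp_continuous_on)
qed

lemma nth_deriv_bounded_of_support:
  assumes "f \<in> Cm m" "\<And>x. r < \<bar>x\<bar> \<Longrightarrow> f x = 0"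
  shows "\<exists>C. \<forall>j\<le>m. \<forall>x. norm (nth_deriv j f x) \<le> C"
proof -
  have "\<exists>C. \<forall>x. norm (nth_deriv j f x) \<le> C" if "j \<le> m" for j
  proof -
    have "bounded (nth_deriv j f ` cball 0 r)"
      using continuous_nth_deriv[OF assms(1) that]
      by (intro compact_imp_bounded compact_continuous_image) (auto elim: continuous_on_subset)
    then obtain C where C: "\<And>x. \<bar>x\<bar> \<le> r \<Longrightarrow> norm (nth_deriv j f x) \<le> C"
      unfolding bounded_iff by force
    \<comment> \<open>For negative \<open>r\<close> the ball is empty and \<open>C\<close> may be
      negative, hence the maximum with 0.\<close>
    have "norm (nth_deriv j f x) \<le> max C 0" for x
    proof (cases "\<bar>x\<bar> \<le> r")
      case False
      then have "nth_deriv j f x = 0"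
        using assms(2) by (intro nth_deriv_eq_0[of "- cball 0 r"]) (auto simp: open_Compl)
      then show ?thesis by simp
    qed (use C in \<open>auto simp: le_max_iff_disj\<close>)
    then show ?thesis by blast
  qed
  then obtain c where c: "\<And>j x. j \<le> m \<Longrightarrow> norm (nth_deriv j f x) \<le> c j" by metis
  have "norm (nth_deriv j f x) \<le> Max (c ` {..m})" if "j \<le> m" for j x
    using c[OF that, of x] that by (meson Max_ge atMost_iff finite_atMost finite_imageI imageI order_trans)
  then show ?thesis by blast
qed

section \<open>Composition and convergence in the multiplier topology\<close>

lemma weight_ge_1: "1 \<le> (1 + x\<^sup>2 :: real)"
  by simp

lemma weight_power_mono: "m \<le> n \<Longrightarrow> (1 + x\<^sup>2 :: real) ^ m \<le> (1 + x\<^sup>2) ^ n"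
  by (rule power_increasing) auto

lemma Omn_norm_le:
  assumes "\<And>j x. j \<le> m \<Longrightarrow> norm (nth_deriv j f x) \<le> C * (1 + x\<^sup>2) ^ n"
  shows "Omn_norm m n f \<le> C"
proof -
  have "norm (nth_deriv j f x) / (1 + x\<^sup>2) ^ n \<le> C" if "j \<le> m" for j x
    using assms[OF that, of x] weight_ge_1[of x]
    by (subst pos_divide_le_eq) (auto intro!: zero_less_power add_pos_nonneg)
  then show ?thesis
    unfolding Omn_norm_def by (intro cSUP_least) auto
qed

lemma norm_nth_deriv_le_Omn_norm:
  assumes "f \<in> Omn m n" "j \<le> m"
  shows "norm (nth_deriv j f x) \<le> Omn_norm m n f * (1 + x\<^sup>2) ^ n"
proof -
  have "norm (nth_deriv j f x) / (1 + x\<^sup>2) ^ n \<le> Omn_norm m n f"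
    unfolding Omn_norm_def
    using assms by (intro cSUP_upper2[where x = "(x, j)"]) (auto simp: Omn_def)
  then show ?thesis
    by (subst (asm) pos_divide_le_eq) (auto intro!: zero_less_power add_pos_nonneg)
qed

lemma OM_imp_Cm: "f \<in> OM \<Longrightarrow> f \<in> Cm m"
proof -
  assume "f \<in> OM"
  then have "f \<in> Om (max 1 m)" by (simp add: OM_def)
  then have "f \<in> Cm (max 1 m)" by (auto simp: Om_def Omn_def)
  then show ?thesis by (rule Cm_mono) simp
qed

lemma Om_I:
  assumes "f \<in> Cm m" "\<And>j x. j \<le> m \<Longrightarrow> norm (nth_deriv j f x) \<le> C * (1 + x\<^sup>2) ^ n"
  shows "f \<in> Om m"
proof -
  have C: "0 \<le> C" using order_trans[OF norm_ge_zero assms(2)[of 0 0]] by simp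
  \<comment> \<open>The steps are indexed by exponents at least 1, while \<open>n\<close> may be 0;
    raising the exponent by one covers this case.\<close>
  have "norm (nth_deriv j f x) \<le> C * (1 + x\<^sup>2) ^ Suc n" if "j \<le> m" for j x
    using assms(2)[OF that, of x] mult_left_mono[OF weight_power_mono[of n "Suc n" x] C] by simp
  then have "f \<in> Omn m (Suc n)"
    unfolding Omn_iff using assms(1) by (auto simp del: power_Suc)
  then show ?thesis by (force simp: Om_def)
qed

lemma Om_E:
  assumes "f \<in> Om m"
  obtains C n where "1 \<le> C" "1 \<le> n" "f \<in> Cm m"
    "\<And>j x. j \<le> m \<Longrightarrow> norm (nth_deriv j f x) \<le> C * (1 + x\<^sup>2) ^ n"
proof -
  obtain n C where n: "1 \<le> n" "f \<in> Cm m"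
    and C: "\<And>j x. j \<le> m \<Longrightarrow> norm (nth_deriv j f x) \<le> C * (1 + x\<^sup>2) ^ n"
    using assms by (auto simp: Om_def Omn_iff)
  have "norm (nth_deriv j f x) \<le> max 1 C * (1 + x\<^sup>2) ^ n" if "j \<le> m" for j x
    using C[OF that, of x] mult_right_mono[of C "max 1 C" "(1 + x\<^sup>2) ^ n"] by auto
  then show thesis using that[of "max 1 C" n] n by auto
qed

lemma OM_I:
  assumes "\<And>m. f \<in> Cm m"
    "\<And>m. \<exists>C n. \<forall>j\<le>m. \<forall>x. norm (nth_deriv j f x) \<le> C * (1 + x\<^sup>2) ^ n"
  shows "f \<in> OM"
proof -
  have "f \<in> Om m" for m using assms(2)[of m] Om_I[OF assms(1)[of m]] by blast
  then show ?thesis by (simp add: OM_def)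
qed

lemma OM_E:
  assumes "f \<in> OM"
  obtains C n where "1 \<le> C" "1 \<le> n"
    "\<And>j x. j \<le> m \<Longrightarrow> norm (nth_deriv j f x) \<le> C * (1 + x\<^sup>2) ^ n"
proof -
  have "f \<in> Om (max 1 m)" using assms by (auto simp: OM_def)
  then show thesis by (rule Om_E) (use that in auto)
qed

text \<open>Composition sends each step boundedly into another one. The exponent \<open>n'\<close>
  and the constant \<open>D\<close> are independent of \<open>h\<close>, which is what continuity on
  the inductive limit requires.\<close>

lemma comp_Omn:
  fixes \<psi> :: "real \<Rightarrow> real"
  assumes "\<psi> \<in> OM" "1 \<le> n"
  obtains n' D where "1 \<le> n'" "0 < D"
    "\<And>h :: real \<Rightarrow> 'a::real_normed_vector. h \<in> Omn m n \<Longrightarrow>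
      h \<circ> \<psi> \<in> Omn m n' \<and> Omn_norm m n' (h \<circ> \<psi>) \<le> D * Omn_norm m n h"
proof -
  obtain C p where C: "1 \<le> C" "1 \<le> p"
    "\<And>j x. j \<le> m \<Longrightarrow> norm (nth_deriv j \<psi> x) \<le> C * (1 + x\<^sup>2) ^ p"
    using assms(1) by (rule OM_E[where m = m]) blast
  \<comment> \<open>The chain rule contributes (C w^p)^m with w = 1 + x^2, and the weight at
    \<psi>(x) contributes (1 + C^2)^n w^(2pn), because |\<psi>(x)| <= C w^p.\<close>
  define D where "D = 2 ^ (m * m) * C ^ m * (1 + C\<^sup>2) ^ n"
  define n' where "n' = p * m + 2 * p * n"
  show thesis
  proof
    show "1 \<le> n'" using C(2) assms(2) mult_le_mono[of 1 p 1 n] unfolding n'_def by linarith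
    show "0 < D" using C by (auto simp: D_def intro!: mult_pos_pos zero_less_power add_pos_nonneg)
    fix h :: "real \<Rightarrow> 'a" assume h: "h \<in> Omn m n"
    let ?N = "Omn_norm m n h"
    have N: "0 \<le> ?N" using order_trans[OF norm_ge_zero norm_nth_deriv_le_Omn_norm[OF h, of 0 0]] by simp
    have cm: "h \<in> Cm m" "\<psi> \<in> Cm m" using h assms(1) by (auto simp: Omn_def OM_imp_Cm)
    have "norm (nth_deriv j (h \<circ> \<psi>) x) \<le> D * ?N * (1 + x\<^sup>2) ^ n'" if "j \<le> m" for j x
    proof -
      let ?w = "1 + x\<^sup>2"
      have B: "1 \<le> C * ?w ^ p" using C mult_mono[of 1 C 1 "?w ^ p"] by (simp add: one_le_power)
      have "(\<psi> x)\<^sup>2 \<le> (C * ?w ^ p)\<^sup>2"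
        using C(3)[of 0 x] power_mono[of "\<bar>\<psi> x\<bar>" _ 2] by simp
      also have "\<dots> = C\<^sup>2 * ?w ^ (2 * p)" by (simp add: power_mult_distrib power_mult mult.commute)
      finally have "1 + (\<psi> x)\<^sup>2 \<le> (1 + C\<^sup>2) * ?w ^ (2 * p)"
        using one_le_power[OF weight_ge_1, of x "2 * p"] unfolding distrib_right mult_1 by linarith
      then have "(1 + (\<psi> x)\<^sup>2) ^ n \<le> ((1 + C\<^sup>2) * ?w ^ (2 * p)) ^ n" by (rule power_mono) auto
      also have "\<dots> = (1 + C\<^sup>2) ^ n * ?w ^ (2 * p * n)" by (simp add: power_mult_distrib power_mult)
      finally have psi: "(1 + (\<psi> x)\<^sup>2) ^ n \<le> (1 + C\<^sup>2) ^ n * ?w ^ (2 * p * n)" .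
      have "norm (nth_deriv j (h \<circ> \<psi>) x)
          \<le> 2 ^ (j * j) * (C * ?w ^ p) ^ j * (?N * ((1 + C\<^sup>2) ^ n * ?w ^ (2 * p * n)))"
      proof (rule norm_nth_deriv_comp_le[OF cm that B])
        fix i assume "i \<le> j"
        then show "norm (nth_deriv i h (\<psi> x)) \<le> ?N * ((1 + C\<^sup>2) ^ n * ?w ^ (2 * p * n))"
          using order_trans[OF norm_nth_deriv_le_Omn_norm[OF h, of i "\<psi> x"] mult_left_mono[OF psi N]] that
          by simp
        show "\<bar>nth_deriv i \<psi> x\<bar> \<le> C * ?w ^ p" using C(3)[of i x] \<open>i \<le> j\<close> that by simp
      qed
      also have "\<dots> \<le> 2 ^ (m * m) * (C * ?w ^ p) ^ m * (?N * ((1 + C\<^sup>2) ^ n * ?w ^ (2 * p * n)))"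
        using that B N by (intro mult_right_mono mult_mono power_increasing) (auto intro: mult_le_mono)
      also have "\<dots> = D * ?N * ?w ^ n'"
        by (simp add: D_def n'_def power_mult_distrib power_add mult_ac flip: power_mult)
      finally show ?thesis .
    qed
    then show "h \<circ> \<psi> \<in> Omn m n' \<and> Omn_norm m n' (h \<circ> \<psi>) \<le> D * ?N"
      using Cm_comp[OF cm] Omn_norm_le[of m "h \<circ> \<psi>" "D * ?N" n'] unfolding Omn_iff by auto
  qed
qed

lemma comp_Om:
  assumes "\<psi> \<in> OM" "f \<in> Om m"
  shows "f \<circ> \<psi> \<in> Om m"
proof -
  obtain n where n: "1 \<le> n" "f \<in> Omn m n" using assms(2) by (auto simp: Om_def)
  obtain n' where "1 \<le> n'" "f \<circ> \<psi> \<in> Omn m n'"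
    using assms(1) n(1) by (rule comp_Omn[where m = m]) (use n(2) in blast)
  then show ?thesis by (auto simp: Om_def)
qed

lemma comp_OM:
  fixes f :: "real \<Rightarrow> 'a::real_normed_vector"
  assumes "\<psi> \<in> OM" "f \<in> OM"
  shows "f \<circ> \<psi> \<in> OM"
  using comp_Om[OF assms(1), of f] assms(2) by (simp add: OM_def[where 'a = 'a])

text \<open>Absolute convexity passes to preimages under a linear map. On step \<open>n\<close> a
  ball of radius \<open>e / D\<close> is sent into the ball of radius \<open>e\<close> of step
  \<open>n'\<close>, and the latter lies in \<open>V\<close>.\<close>

lemma Om_zero_nhd_vimage_comp:
  assumes "\<psi> \<in> OM" "Om_zero_nhd m V"
  shows "Om_zero_nhd m {h \<in> Om m. h \<circ> \<psi> \<in> V}"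
  unfolding Om_zero_nhd_def
proof (intro conjI allI impI)
  have V: "V \<noteq> {}" "\<And>f g a b. f \<in> V \<Longrightarrow> g \<in> V \<Longrightarrow> norm a + norm b \<le> 1 \<Longrightarrow> (\<lambda>x. a * f x + b * g x) \<in> V"
    using assms(2) by (auto simp: Om_zero_nhd_def absolutely_convex_def)
  then obtain f where "f \<in> V" by blast
  then have "(\<lambda>x. 0) \<in> V" using V(2)[of f f 0 0] by simp
  then have "(\<lambda>x. 0) \<in> {h \<in> Om m. h \<circ> \<psi> \<in> V}"
    by (simp add: zero_in_Om o_def)
  moreover have "(\<lambda>x. a * f x + b * g x) \<in> {h \<in> Om m. h \<circ> \<psi> \<in> V}"
    if "f \<in> {h \<in> Om m. h \<circ> \<psi> \<in> V}" "g \<in> {h \<in> Om m. h \<circ> \<psi> \<in> V}" "norm a + norm b \<le> 1" for f g a b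
    using V(2)[of "f \<circ> \<psi>" "g \<circ> \<psi>" a b] that by (auto simp: o_def intro: Om_lincomb)
  ultimately show "absolutely_convex {h \<in> Om m. h \<circ> \<psi> \<in> V}"
    unfolding absolutely_convex_def by blast
  fix n :: nat assume "1 \<le> n"
  obtain n' D where D: "1 \<le> n'" "0 < D"
    "\<And>h :: real \<Rightarrow> complex. h \<in> Omn m n \<Longrightarrow>
      h \<circ> \<psi> \<in> Omn m n' \<and> Omn_norm m n' (h \<circ> \<psi>) \<le> D * Omn_norm m n h"
    using assms(1) \<open>1 \<le> n\<close> by (rule comp_Omn[where m = m]) blast
  obtain e where e: "0 < e" "\<forall>h\<in>Omn m n'. Omn_norm m n' h < e \<longrightarrow> h \<in> V"
    using assms(2) D(1) unfolding Om_zero_nhd_def by blast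
  have "h \<circ> \<psi> \<in> V" if "h \<in> Omn m n" "Omn_norm m n h < e / D" for h
  proof -
    have "D * Omn_norm m n h < e" using that(2) D(2) by (simp add: field_simps)
    then show ?thesis using D(3)[OF that(1)] e(2) by fastforce
  qed
  then show "\<exists>e>0. \<forall>h\<in>Omn m n. Omn_norm m n h < e \<longrightarrow> h \<in> {h \<in> Om m. h \<circ> \<psi> \<in> V}"
    using D(2) e(1) \<open>1 \<le> n\<close> by (intro exI[of _ "e / D"]) (auto simp: Om_def)
qed auto

lemma continuous_map_comp_Om:
  assumes "\<psi> \<in> OM"
  shows "continuous_map (Om_topology m) (Om_topology m) (comp_op \<psi>)"
  unfolding continuous_map_def topspace_Om_topology
proof (intro conjI allI impI)
  show "comp_op \<psi> \<in> Om m \<rightarrow> Om m"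
    unfolding comp_op_def by (intro funcsetI comp_Om[OF assms])
  fix U assume U: "openin (Om_topology m) U"
  show "openin (Om_topology m) {f \<in> Om m. comp_op \<psi> f \<in> U}"
    unfolding openin_Om_topology
  proof (intro conjI ballI)
    fix f assume f: "f \<in> {f \<in> Om m. comp_op \<psi> f \<in> U}"
    then obtain V where V: "Om_zero_nhd m V" "\<forall>h\<in>V. (\<lambda>x. (f \<circ> \<psi>) x + h x) \<in> U"
      using U unfolding openin_Om_topology comp_op_def by blast
    have "(\<lambda>x. f x + h x) \<in> {f \<in> Om m. comp_op \<psi> f \<in> U}" if "h \<in> Om m" "h \<circ> \<psi> \<in> V" for h
      using V(2) that f Om_lincomb[of f m h 1 1] by (auto simp: comp_op_def o_def)
    then show "\<exists>V. Om_zero_nhd m V \<and> (\<forall>h\<in>V. (\<lambda>x. f x + h x) \<in> {f \<in> Om m. comp_op \<psi> f \<in> U})"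
      using Om_zero_nhd_vimage_comp[OF assms V(1)] by blast
  qed auto
qed

lemma continuous_map_comp_OM:
  assumes "\<psi> \<in> OM"
  shows "continuous_map OM_topology OM_topology (comp_op \<psi>)"
proof -
  have "continuous_map OM_topology
      (topology_generated_by (\<Union>m\<in>{1..}. {U \<inter> OM | U. openin (Om_topology m) U})) (comp_op \<psi>)"
  proof (rule continuous_on_generated_topo)
    fix W assume "W \<in> (\<Union>m\<in>{1::nat..}. {U \<inter> OM | U. openin (Om_topology m) U})"
    then obtain m U where W: "1 \<le> m" "W = U \<inter> OM" "openin (Om_topology m) U" by auto
    \<comment> \<open>This inclusion exhibits the preimage of a generating set as the trace on
      \<open>OM\<close> of an open subset of \<open>Om m\<close>, hence again as a generating
      set.\<close>
    have "OM \<subseteq> Om m" using W(1) by (auto simp: OM_def)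
    then have "comp_op \<psi> -` W \<inter> topspace OM_topology = {f \<in> Om m. comp_op \<psi> f \<in> U} \<inter> OM"
      using comp_OM[OF assms] W(2) by (auto simp: topspace_OM_topology comp_op_def)
    moreover have "openin (Om_topology m) {f \<in> Om m. comp_op \<psi> f \<in> U}"
      using continuous_map_comp_Om[OF assms, of m] W(3)
      by (simp add: continuous_map_def topspace_Om_topology)
    ultimately show "openin OM_topology (comp_op \<psi> -` W \<inter> topspace OM_topology)"
      unfolding OM_topology_def using W(1)
      by (intro topology_generated_by_Basis) (auto simp: OM_topology_def)
  next
    have "topspace OM_topology = \<Union> (\<Union>m\<in>{1..}. {U \<inter> OM | U. openin (Om_topology m) U})"
      unfolding OM_topology_def by (rule topology_generated_by_topspace)
    then show "comp_op \<psi> ` topspace OM_topology \<subseteq>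
        \<Union> (\<Union>m\<in>{1..}. {U \<inter> OM | U. openin (Om_topology m) U})"
      using comp_OM[OF assms] by (metis (no_types, lifting) comp_op_def image_subsetI topspace_OM_topology)
  qed
  then show ?thesis by (simp add: OM_topology_def)
qed

text \<open>A zero neighbourhood of the inductive limit contains a ball of every step, so
  convergence in norm inside one step suffices for each \<open>m\<close>. The exponent may depend on
  \<open>m\<close> but not on the index of the sequence.\<close>

lemma limitin_OM_topology:
  assumes s: "\<And>k. s k \<in> OM" and g: "g \<in> OM"
    and lim: "\<And>m. \<exists>n \<epsilon>. \<epsilon> \<longlonglongrightarrow> 0 \<and> (\<forall>\<^sub>F k in sequentially. \<forall>j\<le>m. \<forall>x.
      norm (nth_deriv j (s k) x - nth_deriv j g x) \<le> \<epsilon> k * (1 + x\<^sup>2) ^ n)"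
  shows "limitin OM_topology s g sequentially"
proof -
  let ?B = "\<Union>m\<in>{1..}. {U \<inter> OM | U. openin (Om_topology m) U}"
  have basis: "\<forall>\<^sub>F k in sequentially. s k \<in> U"
    if m: "1 \<le> m" and U: "openin (Om_topology m) U" "g \<in> U" for m U
  proof -
    obtain V where V: "Om_zero_nhd m V" "\<forall>h\<in>V. (\<lambda>x. g x + h x) \<in> U"
      using U unfolding openin_Om_topology by blast
    obtain n \<epsilon> where \<epsilon>: "\<epsilon> \<longlonglongrightarrow> 0" and ev: "\<forall>\<^sub>F k in sequentially. \<forall>j\<le>m. \<forall>x.
      norm (nth_deriv j (s k) x - nth_deriv j g x) \<le> \<epsilon> k * (1 + x\<^sup>2) ^ n" using lim by blast
    have "1 \<le> Suc n" by simp
    then obtain e where e: "0 < e" "\<forall>h\<in>Omn m (Suc n). Omn_norm m (Suc n) h < e \<longrightarrow> h \<in> V"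
      using V(1) unfolding Om_zero_nhd_def by blast
    have "\<forall>\<^sub>F k in sequentially. \<epsilon> k < e" using \<epsilon> e(1) by (rule order_tendstoD)
    with ev show ?thesis
    proof eventually_elim
      fix k assume k: "\<forall>j\<le>m. \<forall>x. norm (nth_deriv j (s k) x - nth_deriv j g x) \<le> \<epsilon> k * (1 + x\<^sup>2) ^ n"
        and "\<epsilon> k < e"
      let ?h = "\<lambda>x. 1 * s k x + (-1) * g x"
      have cm: "s k \<in> Cm m" "g \<in> Cm m" using s g by (auto intro: OM_imp_Cm)
      have "0 \<le> \<epsilon> k" using order_trans[OF norm_ge_zero k[rule_format, of 0 0]] by simp
      then have "norm (nth_deriv j ?h x) \<le> \<epsilon> k * (1 + x\<^sup>2) ^ Suc n" if "j \<le> m" for j x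
        using k[rule_format, OF that, of x] mult_left_mono[OF weight_power_mono[of n "Suc n" x]]
        unfolding nth_deriv_lincomb[OF cm that] by fastforce
      then have "?h \<in> Omn m (Suc n)" "Omn_norm m (Suc n) ?h \<le> \<epsilon> k"
        using Cm_lincomb[OF cm, of 1 "-1"] Omn_norm_le[of m ?h "\<epsilon> k" "Suc n"]
        unfolding Omn_iff by (auto simp del: power_Suc)
      then have "?h \<in> V" using e(2) \<open>\<epsilon> k < e\<close> by auto
      then have "(\<lambda>x. g x + ?h x) \<in> U" by (rule bspec[OF V(2)])
      then show "s k \<in> U" by simp
    qed
  qed
  \<comment> \<open>\<open>basis\<close> settles the generators; finite intersections and unions of
    sets containing \<open>g\<close> inherit the eventual membership.\<close>
  have "\<forall>\<^sub>F k in sequentially. s k \<in> W" if "generate_topology_on ?B W" "g \<in> W" for W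
    using that
  proof (induction rule: generate_topology_on.induct)
    case (Int a b)
    then show ?case by (auto intro: eventually_conj)
  next
    case (UN K)
    then obtain W where "W \<in> K" "g \<in> W" by blast
    then have "\<forall>\<^sub>F k in sequentially. s k \<in> W" by (rule UN.IH)
    then show ?case using \<open>W \<in> K\<close> by (auto elim: eventually_mono)
  next
    case (Basis W)
    then obtain m U where U: "1 \<le> m" "W = U \<inter> OM" "openin (Om_topology m) U" by auto
    then have "\<forall>\<^sub>F k in sequentially. s k \<in> U" using Basis by (intro basis) auto
    then show ?case using U(2) s by simp
  qed auto
  then show ?thesis
    unfolding limitin_def topspace_OM_topology using g
    unfolding OM_topology_def openin_topology_generated_by_iff by blast
qed

section \<open>Countable approximation by smooth functions\<close>

lemma Cm_power: "u \<in> Cm m \<Longrightarrow> (\<lambda>x. u x ^ n :: real) \<in> Cm m"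
  by (induction n) (auto intro: Cm_const Cm_mult)

lemma Cm_sum: "(\<And>k. k \<in> K \<Longrightarrow> f k \<in> Cm m) \<Longrightarrow> (\<lambda>x. \<Sum>k\<in>K. f k x) \<in> Cm m"
  by (induction K rule: infinite_finite_induct) (auto intro: Cm_const Cm_add)

lemma Cm_affine: "(\<lambda>x. c + d * x :: real) \<in> Cm m"
  by (intro Cm_add Cm_mult Cm_const Cm_id)

lemma nth_deriv_const: "nth_deriv (Suc j) (\<lambda>x. c) = (\<lambda>x. 0)"
  by (subst nth_deriv_Suc_eq[where f' = "\<lambda>x. 0"]) (auto simp: nth_deriv_zero)

lemma abs_nth_deriv_affine_le:
  assumes "1 \<le> j"
  shows "\<bar>nth_deriv j (\<lambda>x. c + d * x :: real) x\<bar> \<le> \<bar>d\<bar>"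
proof -
  obtain k where j: "j = Suc k" using assms by (cases j) auto
  have "nth_deriv j (\<lambda>x. c + d * x) = nth_deriv k (\<lambda>x. d)"
    unfolding j by (rule nth_deriv_Suc_eq)
      (auto simp: has_real_derivative_iff_has_vector_derivative[symmetric] intro!: derivative_eq_intros)
  then show ?thesis by (cases k) (auto simp: nth_deriv_const)
qed

lemma Cm_Bernstein:
  assumes "u \<in> Cm m"
  shows "(\<lambda>x. Bernstein n k (u x)) \<in> Cm m"
proof -
  have "(\<lambda>x. 1 + (-1) * u x) \<in> Cm m"
    using assms by (intro Cm_add Cm_mult Cm_const)
  then show ?thesis
    unfolding Bernstein_def using assms by (intro Cm_mult Cm_const Cm_power) auto
qed

text \<open>Used twice: to lift an approximation of derivatives to one of the functions, and to
  integrate a bump to a step. The normalisation at 0 makes the constant of integration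
  explicit.\<close>

lemma antiderivative_exists:
  fixes f :: "real \<Rightarrow> 'a::euclidean_space"
  assumes "continuous_on UNIV f"
  obtains F where "\<And>x. (F has_vector_derivative f x) (at x)" "F 0 = 0"
proof -
  have "\<exists>F. \<forall>x. - \<infinity> < ereal x \<longrightarrow> ereal x < \<infinity> \<longrightarrow> (F has_vector_derivative f x) (at x)"
    using assms by (intro einterval_antiderivative) (auto simp: continuous_on_eq_continuous_at)
  then obtain F where F: "\<And>x. (F has_vector_derivative f x) (at x)" by auto
  show thesis
  proof
    show "((\<lambda>x. F x - F 0) has_vector_derivative f x) (at x)" for x
      using has_vector_derivative_diff[OF F has_vector_derivative_const[of "F 0"], of x] by simp
  qed simp
qed

text \<open>Bernstein polynomials with coefficients from a countable dense set. They are nonnegative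
  on the unit interval and sum to 1, so moving every coefficient by less than \<epsilon> / 3 moves
  the sum by at most \<epsilon> / 3. The other two thirds are spent on the real and the imaginary
  part, which are approximated separately.\<close>

lemma countable_dense_C0:
  fixes a :: real
  assumes "0 < a"
  obtains Q :: "(real \<Rightarrow> complex) set" where "countable Q" "\<And>p m. p \<in> Q \<Longrightarrow> p \<in> Cm m"
    "\<And>g \<epsilon>. continuous_on UNIV g \<Longrightarrow> 0 < \<epsilon> \<Longrightarrow>
      \<exists>p\<in>Q. \<forall>x. \<bar>x\<bar> \<le> a \<longrightarrow> norm (p x - g x) < \<epsilon>"
proof -
  obtain D :: "complex set" where D: "countable D"
    "\<And>X. open X \<Longrightarrow> X \<noteq> {} \<Longrightarrow> \<exists>d\<in>D. d \<in> X"
    using countable_dense_exists by blast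
  \<comment> \<open>The affine map taking the interval from -a to a onto the unit interval;
    \<open>G\<close> below is the target function transported by its inverse.\<close>
  define u where "u x = 1 / 2 + 1 / (2 * a) * x" for x
  define P where "P n c x = (\<Sum>k\<le>n. Bernstein n k (u x) *\<^sub>R (c ! k))"
    for n and c :: "complex list" and x
  have "u \<in> Cm m" for m
    unfolding u_def[abs_def] by (rule Cm_affine)
  then have P: "P n c \<in> Cm m" for n c m
    unfolding P_def[abs_def] by (intro Cm_sum Cm_scaleR Cm_Bernstein Cm_const)
  show thesis
  proof
    show "countable ((\<lambda>(n, c). P n c) ` (UNIV \<times> lists D))"
      using D(1) by (intro countable_image countable_SIGMA countable_lists) auto
    show "p \<in> Cm m" if "p \<in> (\<lambda>(n, c). P n c) ` (UNIV \<times> lists D)" for p m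
      using that P by auto
    fix g :: "real \<Rightarrow> complex" and \<epsilon> :: real
    assume g: "continuous_on UNIV g" and "0 < \<epsilon>"
    define G where "G y = g (a * (2 * y - 1))" for y
    have G: "continuous_on UNIV G" unfolding G_def
      by (intro continuous_on_compose2[OF g] continuous_intros) auto
    have cont: "continuous_on {0..1} (\<lambda>y. Re (G y))" "continuous_on {0..1} (\<lambda>y. Im (G y))"
      by (intro continuous_intros continuous_on_subset[OF G] subset_UNIV)+
    obtain N1 where N1: "\<And>n y. N1 \<le> n \<Longrightarrow> y \<in> {0..1} \<Longrightarrow>
        \<bar>Re (G y) - (\<Sum>k\<le>n. Re (G (k / n)) * Bernstein n k y)\<bar> < \<epsilon> / 3"
      using Bernstein_Weierstrass[OF cont(1), of "\<epsilon> / 3"] \<open>0 < \<epsilon>\<close> by auto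
    obtain N2 where N2: "\<And>n y. N2 \<le> n \<Longrightarrow> y \<in> {0..1} \<Longrightarrow>
        \<bar>Im (G y) - (\<Sum>k\<le>n. Im (G (k / n)) * Bernstein n k y)\<bar> < \<epsilon> / 3"
      using Bernstein_Weierstrass[OF cont(2), of "\<epsilon> / 3"] \<open>0 < \<epsilon>\<close> by auto
    define n where "n = max N1 N2"
    have "\<exists>d\<in>D. d \<in> ball (G (k / n)) (\<epsilon> / 3)" for k :: nat
      using \<open>0 < \<epsilon>\<close> by (intro D(2)) auto
    then obtain d where d: "\<And>k. d k \<in> D" "\<And>k :: nat. dist (G (k / n)) (d k) < \<epsilon> / 3"
      by (simp add: mem_ball) metis
    define c where "c = map d [0..<Suc n]"
    have "norm (P n c x - g x) < \<epsilon>" if "\<bar>x\<bar> \<le> a" for x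
    proof -
      let ?y = "u x"
      let ?S = "\<Sum>k\<le>n. Bernstein n k ?y *\<^sub>R G (k / n)"
      have y: "0 \<le> ?y" "?y \<le> 1" using that \<open>0 < a\<close> by (auto simp: u_def field_simps)
      have gx: "g x = G ?y" using \<open>0 < a\<close> by (simp add: G_def u_def field_simps)
      have "norm (G ?y - ?S) \<le> \<bar>Re (G ?y - ?S)\<bar> + \<bar>Im (G ?y - ?S)\<bar>" by (rule cmod_le)
      also have "\<dots> < \<epsilon> / 3 + \<epsilon> / 3"
        using N1[of n ?y] N2[of n ?y] y by (simp add: n_def mult.commute)
      finally have 1: "norm (G ?y - ?S) < \<epsilon> / 3 + \<epsilon> / 3" .
      have "P n c x - ?S = (\<Sum>k\<le>n. Bernstein n k ?y *\<^sub>R (d k - G (k / n)))"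
        unfolding P_def scaleR_diff_right sum_subtractf
        by (intro arg_cong2[where f = "(-)"] sum.cong refl) (simp add: c_def nth_append del: upt_Suc)
      also have "norm \<dots> \<le> (\<Sum>k\<le>n. Bernstein n k ?y * (\<epsilon> / 3))"
      proof (rule sum_norm_le)
        fix k assume "k \<in> {..n}"
        have "norm (d k - G (k / n)) \<le> \<epsilon> / 3"
          using d(2)[of k] by (simp add: dist_norm norm_minus_commute)
        from mult_left_mono[OF this Bernstein_nonneg[OF y, of n k]]
        show "norm (Bernstein n k ?y *\<^sub>R (d k - G (k / n))) \<le> Bernstein n k ?y * (\<epsilon> / 3)"
          using Bernstein_nonneg[OF y, of n k] by simp
      qed
      also have "\<dots> = \<epsilon> / 3" by (subst sum_distrib_right[symmetric]) simp
      finally have 2: "norm (P n c x - ?S) \<le> \<epsilon> / 3" .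
      show ?thesis
        unfolding gx using 1 2 norm_triangle_ineq4[of "P n c x - ?S" "G ?y - ?S"] by simp
    qed
    moreover have "P n c \<in> (\<lambda>(n, c). P n c) ` (UNIV \<times> lists D)"
      by (intro image_eqI[of _ _ "(n, c)"]) (use d(1) in \<open>auto simp: c_def\<close>)
    ultimately show "\<exists>p\<in>(\<lambda>(n, c). P n c) ` (UNIV \<times> lists D). \<forall>x. \<bar>x\<bar> \<le> a \<longrightarrow> norm (p x - g x) < \<epsilon>"
      by blast
  qed
qed

text \<open>The derivative is approximated first, and the approximant is then integrated from 0 with
  an initial value from a countable dense set. Each order thus reduces to the previous one, and no
  convergence of derivatives of Bernstein polynomials has to be studied.\<close>

lemma countable_dense_Cm:
  fixes a :: real
  assumes "0 < a"
  shows "\<exists>Q :: (real \<Rightarrow> complex) set. countable Q \<and> (\<forall>p\<in>Q. \<forall>k. p \<in> Cm k) \<and>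
    (\<forall>g\<in>Cm m. \<forall>\<epsilon>>0. \<exists>p\<in>Q. \<forall>j\<le>m. \<forall>x. \<bar>x\<bar> \<le> a \<longrightarrow>
      norm (nth_deriv j p x - nth_deriv j g x) < \<epsilon>)"
proof (induction m)
  case 0
  obtain Q :: "(real \<Rightarrow> complex) set" where "countable Q" "\<And>p m. p \<in> Q \<Longrightarrow> p \<in> Cm m"
    "\<And>g \<epsilon>. continuous_on UNIV g \<Longrightarrow> 0 < \<epsilon> \<Longrightarrow>
      \<exists>p\<in>Q. \<forall>x. \<bar>x\<bar> \<le> a \<longrightarrow> norm (p x - g x) < \<epsilon>"
    using assms by (rule countable_dense_C0) blast
  then show ?case by (intro exI[of _ Q]) simp
next
  case (Suc m)
  then obtain Q :: "(real \<Rightarrow> complex) set" where Q: "countable Q" "\<And>p k. p \<in> Q \<Longrightarrow> p \<in> Cm k"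
    "\<And>g \<epsilon>. g \<in> Cm m \<Longrightarrow> 0 < \<epsilon> \<Longrightarrow> \<exists>p\<in>Q. \<forall>j\<le>m. \<forall>x. \<bar>x\<bar> \<le> a \<longrightarrow>
      norm (nth_deriv j p x - nth_deriv j g x) < \<epsilon>" by metis
  obtain D :: "complex set" where D: "countable D"
    "\<And>X. open X \<Longrightarrow> X \<noteq> {} \<Longrightarrow> \<exists>d\<in>D. d \<in> X"
    using countable_dense_exists by blast
  have "\<exists>F. (\<forall>x. (F has_vector_derivative p x) (at x)) \<and> F 0 = 0" if "p \<in> Q" for p
    using antiderivative_exists[of p] Q(2)[OF that, of 0] by auto
  then obtain A where A: "\<And>p x. p \<in> Q \<Longrightarrow> (A p has_vector_derivative p x) (at x)"
    "\<And>p. p \<in> Q \<Longrightarrow> A p 0 = 0" by metis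
  define R where "R d p x = d + A p x" for d :: complex and p and x :: real
  have R: "(R d p has_vector_derivative p x) (at x)" if "p \<in> Q" for d p x
    unfolding R_def
    using has_vector_derivative_add[OF has_vector_derivative_const[of d] A(1)[OF that]] by simp
  have smooth: "R d p \<in> Cm k" if "p \<in> Q" for d p k
    using Cm_SucI[OF R[OF that] Q(2)[OF that]] Cm_Suc_imp_Cm by blast
  have "\<exists>q\<in>(\<lambda>(d, p). R d p) ` (D \<times> Q). \<forall>j\<le>Suc m. \<forall>x. \<bar>x\<bar> \<le> a \<longrightarrow>
      norm (nth_deriv j q x - nth_deriv j g x) < \<epsilon>"
    if g: "g \<in> Cm (Suc m)" and \<epsilon>: "0 < \<epsilon>" for g \<epsilon>
  proof -
    obtain g' where g': "\<And>x. (g has_vector_derivative g' x) (at x)" "g' \<in> Cm m"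
      "\<And>j. nth_deriv (Suc j) g = nth_deriv j g'" using g by (rule Cm_SucE) blast
    \<comment> \<open>Integration over a distance of at most \<open>a\<close> costs
      \<open>\<delta> * a\<close>, which may use half of \<epsilon>; the other half goes to the
      initial value. The bound \<delta> <= \<epsilon> serves the derivatives themselves.\<close>
    define \<delta> where "\<delta> = min \<epsilon> (\<epsilon> / (2 * a))"
    have \<delta>: "0 < \<delta>" "\<delta> \<le> \<epsilon>" "\<delta> * a \<le> \<epsilon> / 2"
      using \<epsilon> assms by (auto simp: \<delta>_def min_def field_simps)
    obtain p where p: "p \<in> Q" "\<And>j x. j \<le> m \<Longrightarrow> \<bar>x\<bar> \<le> a \<Longrightarrow>
        norm (nth_deriv j p x - nth_deriv j g' x) < \<delta>"
      using Q(3)[OF g'(2) \<delta>(1)] by blast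
    have "\<exists>d\<in>D. d \<in> ball (g 0) (\<epsilon> / 2)"
      using \<epsilon> by (intro D(2)) auto
    then obtain d where d: "d \<in> D" "norm (d - g 0) < \<epsilon> / 2"
      by (auto simp: dist_norm norm_minus_commute)
    have "norm (nth_deriv j (R d p) x - nth_deriv j g x) < \<epsilon>" if "j \<le> Suc m" "\<bar>x\<bar> \<le> a" for j x
    proof (cases j)
      case 0
      have "norm ((R d p x - g x) - (R d p 0 - g 0)) \<le> \<delta> * norm (x - 0)"
      proof (rule differentiable_bound[of "cball 0 a"])
        fix t :: real assume "t \<in> cball 0 a"
        show "((\<lambda>x. R d p x - g x) has_derivative (\<lambda>h. h *\<^sub>R (p t - g' t))) (at t within cball 0 a)"
          using has_vector_derivative_diff[OF R[OF p(1), of d t] g'(1)[of t]]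
          by (simp add: has_vector_derivative_def has_derivative_at_withinI)
        have "norm (p t - g' t) < \<delta>"
          using p(2)[of 0 t] \<open>t \<in> cball 0 a\<close> by simp
        then have "norm (h *\<^sub>R (p t - g' t)) \<le> \<delta> * norm h" for h
          using mult_left_mono[of "norm (p t - g' t)" \<delta> "\<bar>h\<bar>"] by (simp add: mult.commute)
        then show "onorm (\<lambda>h. h *\<^sub>R (p t - g' t)) \<le> \<delta>"
          by (rule onorm_bound[rotated]) (use \<delta> in auto)
      qed (use assms that in auto)
      also have "\<dots> \<le> \<delta> * a" using \<delta>(1) that by (intro mult_left_mono) auto
      finally have "norm ((R d p x - g x) - (R d p 0 - g 0)) \<le> \<epsilon> / 2" using \<delta>(3) by simp
      moreover have "R d p 0 = d" using A(2)[OF p(1)] by (simp add: R_def)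
      ultimately have "norm (R d p x - g x) < \<epsilon>"
        using d(2) norm_triangle_sub[of "R d p x - g x" "d - g 0"] by simp
      then show ?thesis using 0 by simp
    next
      case (Suc i)
      then show ?thesis
        using p(2)[of i x] that \<delta>(2) by (simp add: g'(3) nth_deriv_Suc_eq[OF R[OF p(1)]])
    qed
    then show ?thesis using d(1) p(1) by blast
  qed
  moreover have "countable ((\<lambda>(d, p). R d p) ` (D \<times> Q))"
    using D(1) Q(1) by auto
  ultimately show ?case
    using smooth by (intro exI[of _ "(\<lambda>(d, p). R d p) ` (D \<times> Q)"]) auto
qed


section \<open>Smooth cutoffs\<close>

text \<open>The flat function exp(-1/x) together with all factors polynomial in 1/x that
  differentiation can produce. The family is closed under differentiation, so one derivative
  computation yields smoothness of every order.\<close>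

definition exp_poly :: "real poly \<Rightarrow> real \<Rightarrow> real" where
  "exp_poly p x = (if 0 < x then poly p (1 / x) * exp (- 1 / x) else 0)"

lemma tendsto_poly_div_exp_0: "((\<lambda>y. poly p y * exp (- y)) \<longlongrightarrow> 0) at_top" for p :: "real poly"
proof -
  have "((\<lambda>y. \<Sum>i\<le>degree p. coeff p i * (y ^ i / exp y)) \<longlongrightarrow> (\<Sum>i\<le>degree p. coeff p i * 0)) at_top"
    by (intro tendsto_sum tendsto_mult tendsto_const tendsto_power_div_exp_0)
  then show ?thesis
    by (simp add: poly_altdef exp_minus divide_inverse sum_distrib_right mult.assoc)
qed

text \<open>With y = 1/x, differentiating p(y) exp(-y) gives y^2 (p - p')(y) exp(-y), and
  \<open>[:0, 0, 1:]\<close> is the polynomial y^2. At 0 both one-sided difference quotients tend to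
  0.\<close>

lemma has_real_derivative_exp_poly:
  "(exp_poly p has_real_derivative exp_poly ([:0, 0, 1:] * (p - pderiv p)) x) (at x)"
proof -
  consider "0 < x" | "x < 0" | "x = 0" by linarith
  then show ?thesis
  proof cases
    case 1
    have "((\<lambda>x. poly p (1 / x) * exp (- 1 / x)) has_real_derivative
        exp_poly ([:0, 0, 1:] * (p - pderiv p)) x) (at x)"
      using 1 unfolding exp_poly_def
      by (auto intro!: derivative_eq_intros DERIV_chain2[OF poly_DERIV]
          simp: field_simps power2_eq_square)
    then show ?thesis
      by (rule has_field_derivative_transform_within_open[of _ _ _ "{0<..}"])
        (use 1 in \<open>auto simp: exp_poly_def\<close>)
  next
    case 2
    have "((\<lambda>x. 0) has_real_derivative exp_poly ([:0, 0, 1:] * (p - pderiv p)) x) (at x)"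
      using 2 by (simp add: exp_poly_def)
    then show ?thesis
      by (rule has_field_derivative_transform_within_open[of _ _ _ "{..<0}"])
        (use 2 in \<open>auto simp: exp_poly_def\<close>)
  next
    case 3
    have "((\<lambda>h. exp_poly p h / h) \<longlongrightarrow> 0) (at_right 0)"
    proof (rule Lim_transform_eventually)
      \<comment> \<open>Division by \<open>h\<close> multiplies by y = 1/h, and
        \<open>pCons 0 p\<close> is the polynomial y p(y).\<close>
      show "((\<lambda>h. poly (pCons 0 p) (inverse h) * exp (- inverse h)) \<longlongrightarrow> 0) (at_right 0)"
        by (rule filterlim_compose[OF tendsto_poly_div_exp_0 filterlim_inverse_at_top_right])
      show "\<forall>\<^sub>F h in at_right 0. poly (pCons 0 p) (inverse h) * exp (- inverse h) = exp_poly p h / h"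
        unfolding eventually_at_filter
        by (intro always_eventually) (auto simp: exp_poly_def field_simps)
    qed
    moreover have "((\<lambda>h. exp_poly p h / h) \<longlongrightarrow> 0) (at_left 0)"
      by (rule tendsto_eventually)
        (auto simp: eventually_at_filter exp_poly_def intro!: always_eventually)
    ultimately have "((\<lambda>h. exp_poly p h / h) \<longlongrightarrow> 0) (at 0)"
      by (rule filterlim_split_at[rotated])
    then show ?thesis using 3 by (simp add: DERIV_def exp_poly_def)
  qed
qed

lemma Cm_exp_poly: "exp_poly p \<in> Cm m"
proof (induction m arbitrary: p)
  case 0
  show ?case
    using DERIV_isCont[OF has_real_derivative_exp_poly]
    by (simp add: continuous_at_imp_continuous_on)
next
  case (Suc m)
  show ?case
    using has_real_derivative_exp_poly[unfolded has_real_derivative_iff_has_vector_derivative] Suc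
    by (rule Cm_SucI)
qed

text \<open>A product of two flat functions is a bump that is positive exactly between 0 and 1. Its
  antiderivative is constant on either side of this interval, and division by its value at 1
  normalises it.\<close>

lemma smooth_step_exists:
  obtains s :: "real \<Rightarrow> real" where "\<And>m. s \<in> Cm m"
    "\<And>x. x \<le> 0 \<Longrightarrow> s x = 0" "\<And>x. 1 \<le> x \<Longrightarrow> s x = 1"
proof -
  define \<rho> where "\<rho> x = exp_poly 1 x * exp_poly 1 (1 - x)" for x
  have "exp_poly 1 \<circ> (\<lambda>x. 1 + (-1) * x) \<in> Cm m" for m
    by (intro Cm_comp Cm_exp_poly Cm_affine)
  then have \<rho>: "\<rho> \<in> Cm m" for m
    unfolding \<rho>_def by (intro Cm_mult Cm_exp_poly) (simp add: o_def)
  obtain S where S: "\<And>x. (S has_vector_derivative \<rho> x) (at x)" "S 0 = 0"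
    using antiderivative_exists[of \<rho>] \<rho>[of 0] by auto
  have mvt: "\<exists>z>a. z < b \<and> S b - S a = (b - a) * \<rho> z" if "a < b" for a b
    using that S(1) by (intro MVT2) (auto simp: has_real_derivative_iff_has_vector_derivative)
  have S1: "0 < S 1" using mvt[of 0 1] S(2) by (auto simp: \<rho>_def exp_poly_def)
  have S_le_0: "S x = 0" if "x \<le> 0" for x
    using mvt[of x 0] that S(2) by (cases "x = 0") (auto simp: \<rho>_def exp_poly_def)
  have S_ge_1: "S x = S 1" if "1 \<le> x" for x
    using mvt[of 1 x] that by (cases "x = 1") (auto simp: \<rho>_def exp_poly_def)
  show thesis
  proof (rule that[of "\<lambda>x. inverse (S 1) * S x"])
    show "(\<lambda>x. inverse (S 1) * S x) \<in> Cm m" for m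
      using Cm_SucI[OF S(1) \<rho>] by (intro Cm_mult Cm_const) (rule Cm_Suc_imp_Cm)
    show "inverse (S 1) * S x = 0" if "x \<le> 0" for x using S_le_0[OF that] by simp
    show "inverse (S 1) * S x = 1" if "1 \<le> x" for x using S_ge_1[OF that] S1 by simp
  qed
qed

text \<open>All cutoffs are products of a translate and a reflected translate of one step function.
  The transition always has width 1, so the derivatives are bounded independently of
  \<open>i\<close>.\<close>

lemma cutoffs_exist:
  obtains \<eta> :: "nat \<Rightarrow> real \<Rightarrow> real" where "\<And>i m. \<eta> i \<in> Cm m"
    "\<And>i x. \<bar>x\<bar> \<le> i \<Longrightarrow> \<eta> i x = 1" "\<And>i x. i + 1 \<le> \<bar>x\<bar> \<Longrightarrow> \<eta> i x = 0"
    "\<And>m. \<exists>A. \<forall>i. \<forall>j\<le>m. \<forall>x. \<bar>nth_deriv j (\<eta> i) x\<bar> \<le> A"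
proof -
  obtain s :: "real \<Rightarrow> real" where s: "\<And>m. s \<in> Cm m"
    "\<And>x. x \<le> 0 \<Longrightarrow> s x = 0" "\<And>x. 1 \<le> x \<Longrightarrow> s x = 1" by (rule smooth_step_exists) blast
  have "\<exists>A. \<forall>x. \<bar>nth_deriv j s x\<bar> \<le> A" for j
  proof -
    have "bounded (nth_deriv j s ` {0..1})"
      using continuous_nth_deriv[OF s(1)[of j] order_refl]
      by (intro compact_imp_bounded compact_continuous_image) (auto elim: continuous_on_subset)
    then obtain A where A: "\<And>x. x \<in> {0..1} \<Longrightarrow> \<bar>nth_deriv j s x\<bar> \<le> A"
      unfolding bounded_iff by force
    have "\<bar>nth_deriv j s x\<bar> \<le> max A 1" for x
    proof -
      consider "x < 0" | "x \<in> {0..1}" | "1 < x" by fastforce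
      then show ?thesis
      proof cases
        case 1
        then have "nth_deriv j s x = 0"
          using s(2) by (intro nth_deriv_eq_0[of "{..<0}"]) auto
        then show ?thesis by simp
      next
        case 2
        then show ?thesis using A[of x] by simp
      next
        case 3
        then have "nth_deriv j s x = nth_deriv j (\<lambda>x. 1) x"
          using s(3) by (intro nth_deriv_cong_open[of "{1<..}"]) auto
        then show ?thesis by (cases j) (auto simp: nth_deriv_const)
      qed
    qed
    then show ?thesis by blast
  qed
  then obtain a where a: "\<And>j x. \<bar>nth_deriv j s x\<bar> \<le> a j" by metis
  define \<eta> where "\<eta> i x = s (real i + 1 + (-1) * x) * s (real i + 1 + 1 * x)" for i x
  have cm: "s \<circ> (\<lambda>x. c + d * x) \<in> Cm m" for c d m
    by (intro Cm_comp s Cm_affine)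
  have \<eta>: "\<eta> i = (\<lambda>x. (s \<circ> (\<lambda>x. real i + 1 + (-1) * x)) x *\<^sub>R (s \<circ> (\<lambda>x. real i + 1 + 1 * x)) x)" for i
    by (simp add: fun_eq_iff \<eta>_def)
  have "\<exists>A. \<forall>i. \<forall>j\<le>m. \<forall>x. \<bar>nth_deriv j (\<eta> i) x\<bar> \<le> A" for m
  proof (intro exI allI impI)
    fix i j x assume "j \<le> m"
    define M where "M = (\<Sum>j\<le>m. a j)"
    have a0: "0 \<le> a j" for j using order_trans[OF abs_ge_zero a] .
    have aM: "a j \<le> M" if "j \<le> m" for j
      unfolding M_def using that a0 by (intro member_le_sum) auto
    have M: "0 \<le> M" using a0 by (simp add: M_def sum_nonneg)
    have b: "\<bar>nth_deriv k (s \<circ> (\<lambda>x. c + d * x)) x\<bar> \<le> 2 ^ (m * m) * M"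
      if "k \<le> m" "\<bar>d\<bar> = 1" for k c d
    proof -
      have "norm (nth_deriv k (s \<circ> (\<lambda>x. c + d * x)) x) \<le> 2 ^ (k * k) * 1 ^ k * M"
      proof (rule norm_nth_deriv_comp_le[of _ k])
        show "norm (nth_deriv l s (c + d * x)) \<le> M" if "l \<le> k" for l
          using order_trans[OF a[of l "c + d * x"] aM[of l]] that \<open>k \<le> m\<close> by simp
        show "\<bar>nth_deriv l (\<lambda>x. c + d * x) x\<bar> \<le> 1" if "1 \<le> l" for l
          using abs_nth_deriv_affine_le[OF that, of c d x] \<open>\<bar>d\<bar> = 1\<close> by simp
      qed (auto intro: s Cm_affine)
      also have "\<dots> \<le> 2 ^ (m * m) * M"
        using that M by (auto intro!: mult_right_mono power_increasing mult_le_mono)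
      finally show ?thesis by simp
    qed
    have "\<bar>nth_deriv j (\<eta> i) x\<bar> \<le> 2 ^ j * (2 ^ (m * m) * M * (2 ^ (m * m) * M))"
      unfolding \<eta> real_norm_def[symmetric]
    proof (rule norm_nth_deriv_scaleR_le[OF cm cm order_refl])
      fix k assume "k \<le> j"
      then have "k \<le> m" using \<open>j \<le> m\<close> by simp
      then show "\<bar>nth_deriv k (s \<circ> (\<lambda>x. real i + 1 + (-1) * x)) x\<bar> \<le> 2 ^ (m * m) * M"
        "norm (nth_deriv k (s \<circ> (\<lambda>x. real i + 1 + 1 * x)) x) \<le> 2 ^ (m * m) * M"
        unfolding real_norm_def by (intro b; simp)+
    qed
    also have "\<dots> \<le> 2 ^ m * (2 ^ (m * m) * M * (2 ^ (m * m) * M))"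
      using \<open>j \<le> m\<close> M by (intro mult_right_mono power_increasing) auto
    finally show "\<bar>nth_deriv j (\<eta> i) x\<bar> \<le> 2 ^ m * (2 ^ (m * m) * (\<Sum>j\<le>m. a j) * (2 ^ (m * m) * (\<Sum>j\<le>m. a j)))"
      unfolding M_def .
  qed
  note bound = this
  show thesis
  proof (rule that[OF _ _ _ bound])
    show "\<eta> i \<in> Cm m" for i m
      unfolding \<eta> by (intro Cm_scaleR cm)
    show "\<eta> i x = 1" if "\<bar>x\<bar> \<le> i" for i x
      using that s(3) by (auto simp: \<eta>_def)
    show "\<eta> i x = 0" if "i + 1 \<le> \<bar>x\<bar>" for i x
      using that s(2)[of "real i + 1 - x"] s(2)[of "real i + 1 + x"] by (auto simp: \<eta>_def abs_if split: if_splits)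
  qed
qed

text \<open>Approximants on the ball of radius i + 1 are cut off where they are no longer
  controlled. The functions \<open>\<kappa>\<close> are asked to satisfy i <= \<kappa> i because the
  error of the hypercyclic vector will decay in the index of \<open>g\<close>, so that index has to
  tend to infinity.\<close>

lemma approximating_sequence:
  obtains g :: "nat \<Rightarrow> real \<Rightarrow> complex" where "\<And>k m. g k \<in> Cm m"
    "\<And>k. \<exists>r. \<forall>x. r < \<bar>x\<bar> \<longrightarrow> g k x = 0"
    "\<And>h. h \<in> OM \<Longrightarrow> \<exists>\<kappa>. (\<forall>i. i \<le> \<kappa> i) \<and> (\<forall>m. \<exists>C n. \<forall>i\<ge>m. \<forall>j\<le>m. \<forall>x.
      norm (nth_deriv j (g (\<kappa> i)) x - nth_deriv j h x) \<le> C / real (i + 1) * (1 + x\<^sup>2) ^ n)"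
proof -
  obtain \<eta> :: "nat \<Rightarrow> real \<Rightarrow> real" where \<eta>: "\<And>i m. \<eta> i \<in> Cm m"
    "\<And>i x. \<bar>x\<bar> \<le> i \<Longrightarrow> \<eta> i x = 1" "\<And>i x. i + 1 \<le> \<bar>x\<bar> \<Longrightarrow> \<eta> i x = 0"
    "\<And>m. \<exists>A. \<forall>i. \<forall>j\<le>m. \<forall>x. \<bar>nth_deriv j (\<eta> i) x\<bar> \<le> A"
    by (rule cutoffs_exist) blast
  have "\<exists>Q :: (real \<Rightarrow> complex) set. countable Q \<and> (\<forall>p\<in>Q. \<forall>k. p \<in> Cm k) \<and>
    (\<forall>g\<in>Cm i. \<forall>\<epsilon>>0. \<exists>p\<in>Q. \<forall>j\<le>i. \<forall>x. \<bar>x\<bar> \<le> real i + 1 \<longrightarrow>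
      norm (nth_deriv j p x - nth_deriv j g x) < \<epsilon>)" for i
    by (rule countable_dense_Cm) simp
  then obtain Q :: "nat \<Rightarrow> (real \<Rightarrow> complex) set" where Q: "\<And>i. countable (Q i)"
    "\<And>i p k. p \<in> Q i \<Longrightarrow> p \<in> Cm k"
    "\<And>i g \<epsilon>. g \<in> Cm i \<Longrightarrow> 0 < \<epsilon> \<Longrightarrow> \<exists>p\<in>Q i. \<forall>j\<le>i. \<forall>x. \<bar>x\<bar> \<le> real i + 1 \<longrightarrow>
      norm (nth_deriv j p x - nth_deriv j g x) < \<epsilon>" by metis
  define D where "D = (\<Union>i. (\<lambda>p x. \<eta> i x *\<^sub>R p x) ` Q i)"
  have D: "countable D" using Q(1) by (auto simp: D_def)
  have "Q 0 \<noteq> {}" using Q(3)[of "\<lambda>x. 0" 0 1] Cm_const by auto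
  then have "D \<noteq> {}" by (auto simp: D_def)
  \<comment> \<open>Ignoring the second component of the decoded pair lists every element of
    \<open>D\<close> infinitely often, so it can be found at arbitrarily late indices.\<close>
  define g where "g k = from_nat_into D (fst (prod_decode k))" for k
  have g: "g k \<in> D" for k using from_nat_into[OF \<open>D \<noteq> {}\<close>] by (simp add: g_def)
  show thesis
  proof
    show "g k \<in> Cm m" for k m
      using g[of k] by (auto simp: D_def intro!: Cm_scaleR \<eta>(1) intro: Q(2))
    fix k
    obtain i p where "g k = (\<lambda>x. \<eta> i x *\<^sub>R p x)" using g[of k] by (auto simp: D_def)
    then show "\<exists>r. \<forall>x. r < \<bar>x\<bar> \<longrightarrow> g k x = 0"
      using \<eta>(3)[of i] by (intro exI[of _ "real i + 1"]) auto
  next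
    fix h :: "real \<Rightarrow> complex" assume h: "h \<in> OM"
    have "\<exists>p\<in>Q i. \<forall>j\<le>i. \<forall>x. \<bar>x\<bar> \<le> real i + 1 \<longrightarrow>
      norm (nth_deriv j p x - nth_deriv j h x) < 1 / real (i + 1)" for i
      using OM_imp_Cm[OF h] by (intro Q(3)) auto
    then obtain p where p: "\<And>i. p i \<in> Q i" "\<And>i j x. j \<le> i \<Longrightarrow> \<bar>x\<bar> \<le> real i + 1 \<Longrightarrow>
      norm (nth_deriv j (p i) x - nth_deriv j h x) < 1 / real (i + 1)" by metis
    define H where "H i = (\<lambda>x. \<eta> i x *\<^sub>R p i x)" for i
    define \<kappa> where "\<kappa> i = prod_encode (to_nat_on D (H i), i)" for i
    have HD: "H i \<in> D" for i using p(1) by (auto simp: H_def D_def)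
    have g\<kappa>: "g (\<kappa> i) = H i" for i using D HD by (simp add: g_def \<kappa>_def)
    have "\<exists>C n. \<forall>i\<ge>m. \<forall>j\<le>m. \<forall>x.
      norm (nth_deriv j (g (\<kappa> i)) x - nth_deriv j h x) \<le> C / real (i + 1) * (1 + x\<^sup>2) ^ n" for m
    proof -
      obtain C n where C: "1 \<le> C" "\<And>j x. j \<le> m \<Longrightarrow> norm (nth_deriv j h x) \<le> C * (1 + x\<^sup>2) ^ n"
        using h by (rule OM_E[where m = m]) blast
      obtain A where A: "\<And>i j x. j \<le> m \<Longrightarrow> \<bar>nth_deriv j (\<eta> i) x\<bar> \<le> A" using \<eta>(4) by blast
      have A0: "0 \<le> A" using order_trans[OF abs_ge_zero A[of 0]] by simp
      \<comment> \<open>The cut-off approximant contributes \<open>2 ^ m * (A * (C + 1))\<close>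
        through the product estimate, the approximant being within 1 of \<open>h\<close>; the last
        summand \<open>C\<close> bounds \<open>h\<close> itself.\<close>
      define K where "K = 2 ^ m * (A * (C + 1)) + C"
      have K: "1 \<le> K" using A0 C(1) by (simp add: K_def add_increasing)
      have "norm (nth_deriv j (H i) x - nth_deriv j h x) \<le> K / real (i + 1) * (1 + x\<^sup>2) ^ Suc n"
        if "m \<le> i" "j \<le> m" for i j x
      proof (cases "\<bar>x\<bar> < i")
        \<comment> \<open>The cutoff is 1 on the open ball of radius \<open>i\<close>, so only the
          approximation error remains.\<close>
        case True
        then have "nth_deriv j (H i) x = nth_deriv j (p i) x"
          using \<eta>(2)[of _ i] by (intro nth_deriv_cong_open[of "ball 0 i"]) (auto simp: H_def)
        then have "norm (nth_deriv j (H i) x - nth_deriv j h x) \<le> 1 / real (i + 1) * 1"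
          using p(2)[of j i x] that True by simp
        also have "\<dots> \<le> K / real (i + 1) * (1 + x\<^sup>2) ^ Suc n"
          using K by (intro mult_mono divide_right_mono one_le_power) auto
        finally show ?thesis .
      next
        case False
        let ?w = "1 + x\<^sup>2"
        have wn: "1 \<le> ?w ^ n" by (simp add: one_le_power)
        have "norm (nth_deriv j (H i) x) \<le> 2 ^ m * (A * (C + 1)) * ?w ^ n"
        proof (cases "\<bar>x\<bar> \<le> i + 1")
          case True
          have "norm (nth_deriv l (p i) x) \<le> (C + 1) * ?w ^ n" if "l \<le> m" for l
          proof -
            have "norm (nth_deriv l (p i) x - nth_deriv l h x) < 1 / real (i + 1)"
              using p(2)[of l i x] that \<open>m \<le> i\<close> True by simp
            also have "\<dots> \<le> 1" by simp
            finally have "norm (nth_deriv l (p i) x) \<le> 1 + norm (nth_deriv l h x)"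
              using norm_triangle_sub[of "nth_deriv l (p i) x" "nth_deriv l h x"] by simp
            then show ?thesis
              unfolding distrib_right mult_1 using C(2)[OF that, of x] wn by linarith
          qed
          then have "norm (nth_deriv j (H i) x) \<le> 2 ^ j * (A * ((C + 1) * ?w ^ n))"
            unfolding H_def using A Q(2)[OF p(1)] \<eta>(1) \<open>j \<le> m\<close>
            by (intro norm_nth_deriv_scaleR_le[of _ j]) auto
          also have "\<dots> \<le> 2 ^ m * (A * ((C + 1) * ?w ^ n))"
            using \<open>j \<le> m\<close> A0 C(1) by (intro mult_right_mono power_increasing) auto
          finally show ?thesis by (simp add: mult.assoc)
        next
          case False
          then have "nth_deriv j (H i) x = 0"
            using \<eta>(3)[of i] by (intro nth_deriv_eq_0[of "- cball 0 (real i + 1)"])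
              (auto simp: H_def open_Compl)
          then show ?thesis using A0 C(1) by simp
        qed
        then have "norm (nth_deriv j (H i) x - nth_deriv j h x) \<le> K * ?w ^ n"
          using norm_triangle_ineq4[of "nth_deriv j (H i) x" "nth_deriv j h x"] C(2)[OF \<open>j \<le> m\<close>, of x]
          by (simp add: K_def distrib_right)
        also have "\<dots> \<le> K * ?w ^ n * (?w / real (i + 1))"
        proof -
          \<comment> \<open>Away from the ball nothing is small, but 1 + x^2 is at least i + 1
            there: one extra power of the weight buys the factor 1 / (i + 1).\<close>
          have "real i * 1 \<le> real i * real i" by (cases i) auto
          also have "\<dots> \<le> \<bar>x\<bar> * \<bar>x\<bar>" using False by (intro mult_mono) auto
          finally have "1 \<le> ?w / real (i + 1)" by (simp add: power2_eq_square)
          from mult_left_mono[OF this, of "K * ?w ^ n"] show ?thesis using K by simp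
        qed
        finally show ?thesis by (simp add: mult_ac)
      qed
      then show ?thesis unfolding g\<kappa> by blast
    qed
    moreover have "i \<le> \<kappa> i" for i by (simp add: \<kappa>_def le_prod_encode_2)
    ultimately show "\<exists>\<kappa>. (\<forall>i. i \<le> \<kappa> i) \<and> (\<forall>m. \<exists>C n. \<forall>i\<ge>m. \<forall>j\<le>m. \<forall>x.
      norm (nth_deriv j (g (\<kappa> i)) x - nth_deriv j h x) \<le> C / real (i + 1) * (1 + x\<^sup>2) ^ n)"
      by blast
  qed
qed


section \<open>Polynomial bounds and gluing\<close>

text \<open>The hypotheses supply separate constants for each order; finitely many orders allow a
  common choice. The family \<open>F\<close> is left abstract so that the condition near minus
  infinity can be inserted after a reflection.\<close>

lemma uniform_polynomial_bound:
  fixes F :: "nat \<Rightarrow> nat \<Rightarrow> real \<Rightarrow> real"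
  assumes "\<And>j. 1 \<le> j \<Longrightarrow> \<exists>\<beta>. \<exists>C>0. \<exists>t. t \<ge> 1 \<and>
    (\<forall>x\<in>{\<beta><..}. \<forall>n\<ge>1. \<bar>F j n x\<bar> \<le> C * (1 + \<bar>x\<bar>\<^sup>2) ^ t)"
  shows "\<exists>\<beta> C t. 1 \<le> C \<and>
    (\<forall>j x n. 1 \<le> j \<longrightarrow> j \<le> m \<longrightarrow> \<beta> < x \<longrightarrow> 1 \<le> n \<longrightarrow> \<bar>F j n x\<bar> \<le> C * (1 + x\<^sup>2) ^ t)"
proof (induction m)
  case 0
  show ?case by (intro exI[of _ 1]) auto
next
  case (Suc m)
  then obtain \<beta>1 C1 t1 where 1: "1 \<le> C1" "\<And>j x n. 1 \<le> j \<Longrightarrow> j \<le> m \<Longrightarrow> \<beta>1 < x \<Longrightarrow> 1 \<le> n \<Longrightarrow>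
      \<bar>F j n x\<bar> \<le> C1 * (1 + x\<^sup>2) ^ t1" by blast
  have "1 \<le> Suc m" by simp
  from assms[OF this] obtain \<beta>2 C2 t2 where 2: "0 < C2" "\<And>x n. \<beta>2 < x \<Longrightarrow> 1 \<le> n \<Longrightarrow>
      \<bar>F (Suc m) n x\<bar> \<le> C2 * (1 + x\<^sup>2) ^ t2"
    unfolding power2_abs by (meson greaterThan_iff)
  have "\<bar>F j n x\<bar> \<le> max C1 C2 * (1 + x\<^sup>2) ^ max t1 t2"
    if "1 \<le> j" "j \<le> Suc m" "max \<beta>1 \<beta>2 < x" "1 \<le> n" for j x n
  proof (cases "j = Suc m")
    case True
    then have "\<bar>F j n x\<bar> \<le> C2 * (1 + x\<^sup>2) ^ t2" using 2(2) that by simp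
    also have "\<dots> \<le> max C1 C2 * (1 + x\<^sup>2) ^ max t1 t2"
      using 2(1) by (intro mult_mono weight_power_mono) auto
    finally show ?thesis .
  next
    case False
    then have "\<bar>F j n x\<bar> \<le> C1 * (1 + x\<^sup>2) ^ t1" using 1(2) that by simp
    also have "\<dots> \<le> max C1 C2 * (1 + x\<^sup>2) ^ max t1 t2"
      using 1(1) by (intro mult_mono weight_power_mono) auto
    finally show ?thesis .
  qed
  moreover have "1 \<le> max C1 C2" using 1(1) by simp
  ultimately show ?case by blast
qed

text \<open>Far out the weight w = 1 + y^2 dominates both \<open>b\<close> and \<open>k + 1\<close>.
  One extra power of w absorbs the size of \<open>g\<close>, a second one produces 1 / (k + 1);
  hence the summand 2 in the exponent. The remaining constant depends only on \<open>m\<close> and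
  \<open>C\<close>.\<close>

lemma norm_nth_deriv_comp_far_le:
  assumes cm: "g \<in> Cm m" "u \<in> Cm m" and "j \<le> m" "1 \<le> C"
    and g: "\<And>i x. i \<le> m \<Longrightarrow> norm (nth_deriv i g x) \<le> b"
    and u: "\<And>i. 1 \<le> i \<Longrightarrow> i \<le> m \<Longrightarrow> \<bar>nth_deriv i u y\<bar> \<le> C * (1 + y\<^sup>2) ^ t"
    and r: "b \<le> r" "real (k + 1) \<le> r" "r \<le> \<bar>y\<bar>"
  shows "norm (nth_deriv j (g \<circ> u) y) \<le> 2 ^ (m * m) * C ^ m / real (k + 1) * (1 + y\<^sup>2) ^ (t * m + 2)"
proof -
  let ?w = "1 + y\<^sup>2"
  have b: "0 \<le> b" using order_trans[OF norm_ge_zero g[of 0 0]] by simp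
  have B: "1 \<le> C * ?w ^ t" using \<open>1 \<le> C\<close> mult_mono[of 1 C 1 "?w ^ t"] by (simp add: one_le_power)
  have "1 \<le> \<bar>y\<bar>" using r by simp
  then have "\<bar>y\<bar> * 1 \<le> \<bar>y\<bar> * \<bar>y\<bar>" by (intro mult_left_mono) auto
  then have "\<bar>y\<bar> \<le> ?w" by (simp add: power2_eq_square)
  then have w: "b \<le> ?w" "real (k + 1) \<le> ?w" using r by auto
  have "norm (nth_deriv j (g \<circ> u) y) \<le> 2 ^ (j * j) * (C * ?w ^ t) ^ j * b"
    using g u \<open>j \<le> m\<close> by (intro norm_nth_deriv_comp_le[OF cm \<open>j \<le> m\<close> B]) auto
  also have "\<dots> \<le> 2 ^ (m * m) * (C * ?w ^ t) ^ m * b"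
    using \<open>j \<le> m\<close> B b by (intro mult_right_mono mult_mono power_increasing) (auto intro: mult_le_mono)
  also have "\<dots> \<le> 2 ^ (m * m) * (C * ?w ^ t) ^ m * (?w * (?w / real (k + 1)))"
  proof -
    have "1 \<le> ?w / real (k + 1)" using w(2) by simp
    then have "b * 1 \<le> ?w * (?w / real (k + 1))" using w(1) b by (intro mult_mono) auto
    then show ?thesis using B by (intro mult_left_mono) auto
  qed
  also have "\<dots> = 2 ^ (m * m) * C ^ m / real (k + 1) * ?w ^ (t * m + 2)"
    by (simp add: power_mult_distrib power_add power_mult power2_eq_square)
  finally show ?thesis .
qed

text \<open>The right ends \<open>B l\<close> are unbounded, so each point has a neighbourhood
  meeting at most one support. The conclusion is stated on open sets because derivatives of the sum
  are then those of the active summand.\<close>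

lemma glue_disjoint:
  fixes G :: "nat \<Rightarrow> real \<Rightarrow> 'a::real_normed_vector"
  assumes AB: "\<And>l. A l \<le> B l" "\<And>l. B l < A (Suc l)" "\<And>x. \<exists>l. x \<le> B l"
    and supp: "\<And>l x. x < A l \<or> B l < x \<Longrightarrow> G l x = 0"
  shows "\<exists>f. \<forall>x. \<exists>l U. open U \<and> x \<in> U \<and> (\<forall>y\<in>U. f y = G l y) \<and> (\<forall>y\<in>U. \<forall>l'. l' \<noteq> l \<longrightarrow> G l' y = 0)"
proof (intro exI[of _ "\<lambda>y. \<Sum>l. G l y"] allI)
  fix x
  \<comment> \<open>Minimality gives B (l - 1) < x <= B l < A (l + 1), so \<open>x\<close> lies in
    the open interval between the neighbouring supports; for l = 0 there is no left
    neighbour.\<close>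
  define l where "l = (LEAST l. x \<le> B l)"
  have l: "x \<le> B l" "\<And>k. k < l \<Longrightarrow> B k < x"
    unfolding l_def using AB(3)[of x] by (rule LeastI_ex, use not_less_Least not_le in blast)
  have Bmono: "B k \<le> B k'" if "k \<le> k'" for k k'
    by (rule lift_Suc_mono_le[OF _ that]) (use AB in \<open>meson less_imp_le order_trans\<close>)
  have Amono: "A k \<le> A k'" if "k \<le> k'" for k k'
    by (rule lift_Suc_mono_le[OF _ that]) (use AB in \<open>meson less_imp_le order_trans\<close>)
  define U where "U = (if l = 0 then {..< A (Suc l)} else {B (l - 1) <..< A (Suc l)})"
  have "open U" "x \<in> U"
    using l AB(2)[of l] by (auto simp: U_def)
  moreover have zero: "G l' y = 0" if "y \<in> U" "l' \<noteq> l" for y l'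
  proof (cases "l < l'")
    case True
    then have "y < A l'" using that(1) Amono[of "Suc l" l'] by (auto simp: U_def split: if_splits)
    then show ?thesis using supp by blast
  next
    case False
    then have "l' \<le> l - 1" "l \<noteq> 0" using that(2) by auto
    then have "B l' < y" using that(1) Bmono[of l' "l - 1"] by (auto simp: U_def)
    then show ?thesis using supp by blast
  qed
  moreover have "(\<Sum>l. G l y) = G l y" if "y \<in> U" for y
    using suminf_finite[of "{l}" "\<lambda>l. G l y"] zero[OF that] by simp
  ultimately show "\<exists>l U. open U \<and> x \<in> U \<and> (\<forall>y\<in>U. (\<Sum>l. G l y) = G l y) \<and>
      (\<forall>y\<in>U. \<forall>l'. l' \<noteq> l \<longrightarrow> G l' y = 0)" by blast
qed

section \<open>Hypercyclic vectors\<close>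

locale increasing_flow =
  fixes \<psi> :: "real \<Rightarrow> real"
  assumes smooth: "\<psi> \<in> Cm m"
    and bij: "bij \<psi>"
    and gt: "x < \<psi> x"
    and deriv_pos: "0 < deriv \<psi> x"
begin

section \<open>Iterates of the flow map and their inverses\<close>

lemma DERIV_psi: "(\<psi> has_real_derivative deriv \<psi> x) (at x)"
proof -
  have "\<psi> differentiable at x" using smooth[of "Suc 0"] unfolding Cm_Suc by blast
  then show ?thesis unfolding DERIV_deriv_iff_real_differentiable .
qed

lemma smooth_iter: "\<psi> ^^ n \<in> Cm m"
proof (induction n)
  case 0
  then show ?case using Cm_id by (simp add: id_def)
next
  case (Suc n)
  show ?case unfolding funpow.simps using smooth Suc by (rule Cm_comp)
qed

lemma bij_iter: "bij (\<psi> ^^ n)"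
  using bij by (rule bij_fn)

lemma iter_inv [simp]: "(\<psi> ^^ n) (inv (\<psi> ^^ n) x) = x" "inv (\<psi> ^^ n) ((\<psi> ^^ n) x) = x"
  using bij_iter[of n] by (simp_all add: bij_is_surj surj_f_inv_f bij_is_inj)

lemma DERIV_iter: "\<exists>d. \<forall>x. ((\<psi> ^^ n) has_real_derivative d x) (at x) \<and> 0 < d x"
proof (induction n)
  case 0
  show ?case by (auto simp: id_def intro!: exI[of _ "\<lambda>x. 1"])
next
  case (Suc n)
  then obtain d where d: "\<And>x. ((\<psi> ^^ n) has_real_derivative d x) (at x)" "\<And>x. 0 < d x" by blast
  have "((\<psi> ^^ Suc n) has_real_derivative deriv \<psi> ((\<psi> ^^ n) x) * d x) (at x)" for x
    using DERIV_chain[OF DERIV_psi d(1)] by simp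
  moreover have "0 < deriv \<psi> ((\<psi> ^^ n) x) * d x" for x
    using d(2) deriv_pos by (intro mult_pos_pos)
  ultimately show ?case by (intro exI[of _ "\<lambda>x. deriv \<psi> ((\<psi> ^^ n) x) * d x"]) blast
qed

lemma smooth_inv_iter: "inv (\<psi> ^^ n) \<in> Cm m"
proof -
  obtain d where "\<And>x. ((\<psi> ^^ n) has_real_derivative d x) (at x)" "\<And>x. 0 < d x"
    using DERIV_iter[of n] by blast
  then show ?thesis by (rule Cm_inv[OF smooth_iter bij_iter])
qed

lemma strict_mono_iter: "strict_mono (\<psi> ^^ n)"
proof (rule strict_monoI)
  fix x y :: real assume "x < y"
  then show "(\<psi> ^^ n) x < (\<psi> ^^ n) y"
    by (rule DERIV_pos_imp_increasing) (use DERIV_iter[of n] in blast)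
qed

lemma iter_less_iff [simp]: "(\<psi> ^^ n) x < (\<psi> ^^ n) y \<longleftrightarrow> x < y"
  using strict_mono_iter by (rule strict_mono_less)

lemma iter_le_iff [simp]: "(\<psi> ^^ n) x \<le> (\<psi> ^^ n) y \<longleftrightarrow> x \<le> y"
  using strict_mono_iter by (rule strict_mono_less_eq)

lemma inv_iter_less_iff: "inv (\<psi> ^^ n) x < y \<longleftrightarrow> x < (\<psi> ^^ n) y"
  using iter_less_iff[of n "inv (\<psi> ^^ n) x" y] by simp

lemma less_inv_iter_iff: "y < inv (\<psi> ^^ n) x \<longleftrightarrow> (\<psi> ^^ n) y < x"
  using iter_less_iff[of n y "inv (\<psi> ^^ n) x"] by simp

lemma iter_mono_exponent: "n \<le> n' \<Longrightarrow> (\<psi> ^^ n) x \<le> (\<psi> ^^ n') x"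
  by (rule lift_Suc_mono_le[of "\<lambda>n. (\<psi> ^^ n) x"]) (auto intro: less_imp_le[OF gt])

lemma open_iter_vimage: "open U \<Longrightarrow> open ((\<psi> ^^ n) -` U)"
  using smooth_iter[of n 0] by (simp add: open_vimage)

text \<open>A bounded orbit would converge to a fixed point of \<open>\<psi>\<close>.\<close>

lemma iter_unbounded: "\<exists>n. y < (\<psi> ^^ n) x"
proof (rule ccontr)
  assume "\<nexists>n. y < (\<psi> ^^ n) x"
  then have bd: "\<forall>n. (\<psi> ^^ n) x \<le> y" by (simp add: not_less)
  have "incseq (\<lambda>n. (\<psi> ^^ n) x)" by (simp add: incseq_def iter_mono_exponent)
  then obtain L where L: "(\<lambda>n. (\<psi> ^^ n) x) \<longlonglongrightarrow> L" using bd by (rule incseq_convergent)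
  have "(\<lambda>n. \<psi> ((\<psi> ^^ n) x)) \<longlonglongrightarrow> \<psi> L"
    using isCont_tendsto_compose[OF DERIV_isCont[OF DERIV_psi] L] .
  moreover have "(\<lambda>n. \<psi> ((\<psi> ^^ n) x)) \<longlonglongrightarrow> L"
    using LIMSEQ_Suc[OF L] by simp
  ultimately have "\<psi> L = L" by (rule LIMSEQ_unique)
  with gt[of L] show False by simp
qed

end

locale hypercyclic_flow = increasing_flow +
  assumes bound_inv: "1 \<le> j \<Longrightarrow> \<exists>\<beta>. \<exists>C>0. \<exists>t. t \<ge> 1 \<and>
      (\<forall>x\<in>{\<beta><..}. \<forall>n\<ge>1. \<bar>nth_deriv j (inv (\<psi> ^^ n)) x\<bar> \<le> C * (1 + \<bar>x\<bar>\<^sup>2) ^ t)"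
    and bound_fwd: "1 \<le> j \<Longrightarrow> \<exists>\<alpha>. \<exists>C>0. \<exists>t. t \<ge> 1 \<and>
      (\<forall>x\<in>{..<\<alpha>}. \<forall>n\<ge>1. \<bar>nth_deriv j (\<psi> ^^ n) x\<bar> \<le> C * (1 + \<bar>x\<bar>\<^sup>2) ^ t)"
begin

text \<open>The weight is even, so the reflection x -> -x turns the condition near minus infinity
  into one near plus infinity, and a single triple of constants serves both ends.\<close>

lemma uniform_bounds:
  obtains \<beta> C t where "1 \<le> C"
    "\<And>j x n. 1 \<le> j \<Longrightarrow> j \<le> m \<Longrightarrow> \<beta> < x \<Longrightarrow> 1 \<le> n \<Longrightarrow>
      \<bar>nth_deriv j (inv (\<psi> ^^ n)) x\<bar> \<le> C * (1 + x\<^sup>2) ^ t"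
    "\<And>j x n. 1 \<le> j \<Longrightarrow> j \<le> m \<Longrightarrow> x < - \<beta> \<Longrightarrow> 1 \<le> n \<Longrightarrow>
      \<bar>nth_deriv j (\<psi> ^^ n) x\<bar> \<le> C * (1 + x\<^sup>2) ^ t"
proof -
  obtain \<beta>1 C1 t1 where 1: "1 \<le> C1" "\<And>j x n. 1 \<le> j \<Longrightarrow> j \<le> m \<Longrightarrow> \<beta>1 < x \<Longrightarrow> 1 \<le> n \<Longrightarrow>
      \<bar>nth_deriv j (inv (\<psi> ^^ n)) x\<bar> \<le> C1 * (1 + x\<^sup>2) ^ t1"
    using uniform_polynomial_bound[of "\<lambda>j n. nth_deriv j (inv (\<psi> ^^ n))" m, OF bound_inv] by blast
  have "\<exists>\<beta>. \<exists>C>0. \<exists>t\<ge>1. \<forall>x\<in>{\<beta><..}. \<forall>n\<ge>1.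
      \<bar>nth_deriv j (\<psi> ^^ n) (- x)\<bar> \<le> C * (1 + \<bar>x\<bar>\<^sup>2) ^ t" if j: "1 \<le> j" for j
  proof -
    from bound_fwd[OF j] obtain \<alpha> C t where "0 < C" "1 \<le> t" "\<And>x n. x < \<alpha> \<Longrightarrow> 1 \<le> n \<Longrightarrow>
        \<bar>nth_deriv j (\<psi> ^^ n) x\<bar> \<le> C * (1 + \<bar>x\<bar>\<^sup>2) ^ t" by (meson lessThan_iff)
    note * = this(1,2) this(3)[of "- x" for x]
    show ?thesis
      using * by (intro exI[of _ "- \<alpha>"] exI[of _ C] exI[of _ t] conjI ballI allI impI) auto
  qed
  then obtain \<beta>2 C2 t2 where 2: "1 \<le> C2" "\<And>j x n. 1 \<le> j \<Longrightarrow> j \<le> m \<Longrightarrow> \<beta>2 < x \<Longrightarrow> 1 \<le> n \<Longrightarrow>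
      \<bar>nth_deriv j (\<psi> ^^ n) (- x)\<bar> \<le> C2 * (1 + x\<^sup>2) ^ t2"
    using uniform_polynomial_bound[of "\<lambda>j n x. nth_deriv j (\<psi> ^^ n) (- x)" m] by blast
  let ?C = "max C1 C2" and ?t = "max t1 t2"
  have le: "C1 * (1 + x\<^sup>2) ^ t1 \<le> ?C * (1 + x\<^sup>2) ^ ?t" "C2 * (1 + x\<^sup>2) ^ t2 \<le> ?C * (1 + x\<^sup>2) ^ ?t"
    for x using 1(1) 2(1) by (auto intro!: mult_mono weight_power_mono)
  show thesis
  proof (rule that[of ?C "max \<beta>1 \<beta>2" ?t])
    show "1 \<le> ?C" using 1(1) by simp
  next
    fix j x and n :: nat assume "1 \<le> j" "j \<le> m" "max \<beta>1 \<beta>2 < x" "1 \<le> n"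
    then show "\<bar>nth_deriv j (inv (\<psi> ^^ n)) x\<bar> \<le> ?C * (1 + x\<^sup>2) ^ ?t"
      using order_trans[OF 1(2) le(1)] by simp
  next
    fix j x and n :: nat assume "1 \<le> j" "j \<le> m" "x < - max \<beta>1 \<beta>2" "1 \<le> n"
    then show "\<bar>nth_deriv j (\<psi> ^^ n) x\<bar> \<le> ?C * (1 + x\<^sup>2) ^ ?t"
      using order_trans[OF 2(2)[of j "- x" n] le(2)[of "- x"]] by simp
  qed
qed

text \<open>A single scale \<open>R k\<close> for support, size and index. The derivative bound is
  diagonal, up to order \<open>k\<close> at index \<open>k\<close>, so that it does not refer to a
  fixed order, yet covers any order \<open>m\<close> once m <= k.\<close>

lemma bounds_of_compactly_supported:
  fixes g :: "nat \<Rightarrow> real \<Rightarrow> 'a::real_normed_vector"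
  assumes "\<And>k m. g k \<in> Cm m" "\<And>k. \<exists>r. \<forall>x. r < \<bar>x\<bar> \<longrightarrow> g k x = 0"
  obtains R where "mono R" "\<And>k. real (k + 1) \<le> R k" "\<And>k x. R k < \<bar>x\<bar> \<Longrightarrow> g k x = 0"
    "\<And>k l j x. l \<le> k \<Longrightarrow> j \<le> k \<Longrightarrow> norm (nth_deriv j (g l) x) \<le> R k"
proof -
  obtain r where r: "\<And>k x. r k < \<bar>x\<bar> \<Longrightarrow> g k x = 0" using assms(2) by metis
  have "\<exists>C. \<forall>j\<le>k. \<forall>x. norm (nth_deriv j (g l) x) \<le> C" for k l
    using nth_deriv_bounded_of_support[OF assms(1) r] .
  then obtain c where c: "\<And>k l j x. j \<le> k \<Longrightarrow> norm (nth_deriv j (g l) x) \<le> c k l" by metis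
  have c0: "0 \<le> c k l" for k l using order_trans[OF norm_ge_zero c[of 0]] by simp
  \<comment> \<open>The summand 1 makes every \<open>b k\<close> at least 1, so that the partial
    sums \<open>R k\<close> increase and reach k + 1.\<close>
  define b where "b k = 1 + \<bar>r k\<bar> + (\<Sum>l\<le>k. c k l)" for k
  have b: "1 \<le> b k" "r k \<le> b k" for k
    using sum_nonneg[of "{..k}" "c k"] c0 by (auto simp: b_def)
  have cb: "c k l \<le> b k" if "l \<le> k" for k l
    using member_le_sum[of l "{..k}" "c k"] that c0 by (simp add: b_def)
  define R where "R k = (\<Sum>i\<le>k. b i)" for k
  have bR: "b k \<le> R k" for k
    unfolding R_def using b(1) by (intro member_le_sum) (auto intro: order_trans[OF zero_le_one])
  show thesis
  proof (rule that[of R])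
    show "mono R"
      unfolding mono_iff_le_Suc using b(1) by (auto simp: R_def intro: order_trans[OF zero_le_one])
    show "real (k + 1) \<le> R k" for k
      using sum_mono[of "{..k}" "\<lambda>i. 1" b] b(1) by (simp add: R_def)
    show "g k x = 0" if "R k < \<bar>x\<bar>" for k x
      using r[of k x] that b(2)[of k] bR[of k] by linarith
    show "norm (nth_deriv j (g l) x) \<le> R k" if "l \<le> k" "j \<le> k" for k l j x
      using c[OF that(2), of l x] cb[OF that(1)] bR[of k] by linarith
  qed
qed

text \<open>The error carries an explicit rate because it is evaluated later along indices \<kappa>
  i >= i. The constant, the exponent and the threshold may depend on \<open>m\<close>; the vector
  and \<nu> may not.\<close>

lemma hypercyclic_vector:
  fixes g :: "nat \<Rightarrow> real \<Rightarrow> complex"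
  assumes g: "\<And>k m. g k \<in> Cm m" and "\<And>k. \<exists>r. \<forall>x. r < \<bar>x\<bar> \<longrightarrow> g k x = 0"
  obtains f \<nu> where "f \<in> OM"
    "\<And>m. \<exists>C n k0. 0 \<le> C \<and> (\<forall>k\<ge>k0. \<forall>j\<le>m. \<forall>x.
      norm (nth_deriv j (f \<circ> \<psi> ^^ \<nu> k) x - nth_deriv j (g k) x) \<le> C / real (k + 1) * (1 + x\<^sup>2) ^ n)"
proof -
  obtain R where R: "mono R" "\<And>k. real (k + 1) \<le> R k" "\<And>k x. R k < \<bar>x\<bar> \<Longrightarrow> g k x = 0"
    "\<And>k l j x. l \<le> k \<Longrightarrow> j \<le> k \<Longrightarrow> norm (nth_deriv j (g l) x) \<le> R k"
    using assms by (rule bounds_of_compactly_supported[of g]) blast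
  have R1: "1 \<le> R k" for k using R(2)[of k] by simp
  have "\<exists>N. \<forall>k. R k < (\<psi> ^^ N k) (- R k)"
    by (rule choice) (blast intro: iter_unbounded)
  then obtain N where N: "\<And>k. R k < (\<psi> ^^ N k) (- R k)" by blast
  have far: "R k < (\<psi> ^^ d) (- R k)" if "N k \<le> d" for k d
    using N[of k] iter_mono_exponent[OF that, of "- R k"] by linarith
  have N1: "1 \<le> N k" for k
    using N[of k] R1[of k] by (cases "N k") auto
  \<comment> \<open>Partial sums make every difference \<nu> l - \<nu> k with k < l at least
    \<open>N l\<close>, the waiting time of the larger index.\<close>
  define \<nu> where "\<nu> k = (\<Sum>i\<le>k. N i)" for k
  have \<nu>N: "N k \<le> \<nu> k" for k
    unfolding \<nu>_def by (rule member_le_sum) auto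
  have gap: "\<exists>d. \<nu> l = \<nu> k + d \<and> N l \<le> d \<and> 1 \<le> d" if kl: "k < l" for k l
  proof -
    obtain l' where l': "l = Suc l'" using kl by (cases l) auto
    have "\<nu> k \<le> \<nu> l'" unfolding \<nu>_def using kl l' by (intro sum_mono2) auto
    moreover have "\<nu> l = \<nu> l' + N l" by (simp add: \<nu>_def l')
    ultimately show ?thesis using N1[of l] by (intro exI[of _ "\<nu> l - \<nu> k"]) auto
  qed
  define G where "G l = g l \<circ> inv (\<psi> ^^ \<nu> l)" for l
  define A where "A l = (\<psi> ^^ \<nu> l) (- R l)" for l
  define B where "B l = (\<psi> ^^ \<nu> l) (R l)" for l
  have G: "G l \<in> Cm m" for l m
    unfolding G_def using g smooth_inv_iter by (rule Cm_comp)
  have supp: "G l x = 0" if "x < A l \<or> B l < x" for l x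
  proof -
    have "inv (\<psi> ^^ \<nu> l) x < - R l \<or> R l < inv (\<psi> ^^ \<nu> l) x"
      using that by (simp add: A_def B_def inv_iter_less_iff less_inv_iter_iff)
    then show ?thesis by (auto simp: G_def intro!: R(3))
  qed
  have RB: "R l \<le> B l" for l
    using iter_mono_exponent[of 0 "\<nu> l" "R l"] by (simp add: B_def)
  have A_le_B: "A l \<le> B l" for l using R1[of l] by (simp add: A_def B_def)
  have B_less_A: "B l < A (Suc l)" for l
  proof -
    obtain d where d: "\<nu> (Suc l) = \<nu> l + d" "N (Suc l) \<le> d" using gap[of l "Suc l"] by auto
    have "R l \<le> R (Suc l)" using R(1) by (simp add: monoD)
    also have "\<dots> < (\<psi> ^^ d) (- R (Suc l))" using d(2) by (rule far)
    \<comment> \<open>Both endpoints are images under the increasing iterate of order \<nu> l, so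
      the comparison reduces to R l < \<psi>^d(- R (l + 1)).\<close>
    finally show ?thesis by (simp add: A_def B_def d(1) funpow_add)
  qed
  have B_unbounded: "\<exists>l. x \<le> B l" for x
  proof -
    obtain l :: nat where "x \<le> l" using real_arch_simple by blast
    then show ?thesis using R(2)[of l] RB[of l] by (intro exI[of _ l]) simp
  qed
  from glue_disjoint[OF A_le_B B_less_A B_unbounded supp]
  obtain f where f_ex: "\<forall>x. \<exists>l U. open U \<and> x \<in> U \<and> (\<forall>y\<in>U. f y = G l y) \<and>
      (\<forall>y\<in>U. \<forall>l'. l' \<noteq> l \<longrightarrow> G l' y = 0)" ..
  note f = spec[OF f_ex]
  have f_smooth: "f \<in> Cm m" for m
    by (rule Cm_locally) (use f G in meson)
  \<comment> \<open>Later bumps. To the right of \<open>R l\<close> the inverse bounds apply;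
    elsewhere the composition vanishes near \<open>y\<close>, its support starting at \<psi>^d(- R
    l) > R l.\<close>
  have right: "norm (nth_deriv j (g l \<circ> inv (\<psi> ^^ d)) y) \<le> 2 ^ (m * m) * C ^ m / real (l + 1) * (1 + y\<^sup>2) ^ (t * m + 2)"
    if "1 \<le> C" and u: "\<And>j x n. 1 \<le> j \<Longrightarrow> j \<le> m \<Longrightarrow> \<beta> < x \<Longrightarrow> 1 \<le> n \<Longrightarrow>
      \<bar>nth_deriv j (inv (\<psi> ^^ n)) x\<bar> \<le> C * (1 + x\<^sup>2) ^ t"
      and "j \<le> m" "m \<le> l" "\<beta> \<le> R l" "N l \<le> d" for m C \<beta> t j l d y
  proof (cases "R l < y")
    case True
    have "1 \<le> d" using N1[of l] that by simp
    show ?thesis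
      by (rule norm_nth_deriv_comp_far_le[OF g smooth_inv_iter \<open>j \<le> m\<close> \<open>1 \<le> C\<close>, where b = "R l" and r = "R l"])
        (use R(4)[of l l] R(2)[of l] True \<open>m \<le> l\<close> \<open>\<beta> \<le> R l\<close> \<open>1 \<le> d\<close> in \<open>auto intro!: u\<close>)
  next
    case False
    have "(g l \<circ> inv (\<psi> ^^ d)) z = 0" if "z < (\<psi> ^^ d) (- R l)" for z
      using that R1[of l] by (auto intro!: R(3) simp: inv_iter_less_iff[symmetric])
    then have "nth_deriv j (g l \<circ> inv (\<psi> ^^ d)) y = 0"
      using False far[OF \<open>N l \<le> d\<close>]
      by (intro nth_deriv_eq_0[of "{..< (\<psi> ^^ d) (- R l)}"]) auto
    then show ?thesis using \<open>1 \<le> C\<close> by simp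
  qed
  \<comment> \<open>Earlier bumps. The scale is that of the larger index \<open>k\<close>: at points
    not below \<open>- R k\<close> the flow has already passed \<open>R k\<close>, hence the support
    of \<open>g l\<close>, while below \<open>- R k\<close> the forward bounds apply.\<close>
  have left: "norm (nth_deriv j (g l \<circ> \<psi> ^^ d) y) \<le> 2 ^ (m * m) * C ^ m / real (k + 1) * (1 + y\<^sup>2) ^ (t * m + 2)"
    if "1 \<le> C" and u: "\<And>j x n. 1 \<le> j \<Longrightarrow> j \<le> m \<Longrightarrow> x < - \<beta> \<Longrightarrow> 1 \<le> n \<Longrightarrow>
      \<bar>nth_deriv j (\<psi> ^^ n) x\<bar> \<le> C * (1 + x\<^sup>2) ^ t"
      and "j \<le> m" "m \<le> k" "\<beta> \<le> R k" "l \<le> k" "N k \<le> d" for m C \<beta> t j l k d y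
  proof (cases "y < - R k")
    case True
    have "1 \<le> d" using N1[of k] that by simp
    show ?thesis
      by (rule norm_nth_deriv_comp_far_le[OF g smooth_iter \<open>j \<le> m\<close> \<open>1 \<le> C\<close>, where b = "R k" and r = "R k"])
        (use R(4)[OF \<open>l \<le> k\<close>] R(2)[of k] True \<open>m \<le> k\<close> \<open>\<beta> \<le> R k\<close> \<open>1 \<le> d\<close> in \<open>auto intro!: u\<close>)
  next
    case False
    have "R l \<le> R k" using R(1) \<open>l \<le> k\<close> by (simp add: monoD)
    then have "(g l \<circ> \<psi> ^^ d) z = 0" if "R k < (\<psi> ^^ d) z" for z
      using that R1[of l] by (auto intro!: R(3))
    moreover have "R k < (\<psi> ^^ d) y"
      using far[OF \<open>N k \<le> d\<close>] False by (meson iter_le_iff less_le_trans not_less)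
    moreover have "open ((\<psi> ^^ d) -` {R k <..})" by (rule open_iter_vimage) simp
    ultimately have "nth_deriv j (g l \<circ> \<psi> ^^ d) y = 0"
      by (intro nth_deriv_eq_0[of "(\<psi> ^^ d) -` {R k <..}"]) auto
    then show ?thesis using \<open>1 \<le> C\<close> by simp
  qed
  have large: "\<exists>k0. m \<le> k0 \<and> (\<forall>k\<ge>k0. m \<le> k \<and> \<beta> \<le> R k)" for m \<beta>
  proof -
    obtain k1 :: nat where k1: "\<beta> \<le> k1" using real_arch_simple by blast
    have "m \<le> k \<and> \<beta> \<le> R k" if "max m k1 \<le> k" for k using that k1 R(2)[of k] by simp
    then show ?thesis by (intro exI[of _ "max m k1"]) auto
  qed
  have "f \<in> OM"
  proof (rule OM_I)
    fix m
    obtain \<beta> C t where C: "1 \<le> C" and u: "\<And>j x n. 1 \<le> j \<Longrightarrow> j \<le> m \<Longrightarrow> \<beta> < x \<Longrightarrow> 1 \<le> n \<Longrightarrow>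
      \<bar>nth_deriv j (inv (\<psi> ^^ n)) x\<bar> \<le> C * (1 + x\<^sup>2) ^ t"
      by (rule uniform_bounds[of m]) blast
    obtain l0 where l0: "\<And>l. l0 \<le> l \<Longrightarrow> m \<le> l \<and> \<beta> \<le> R l" using large[of m \<beta>] by blast
    define K where "K = 2 ^ (m * m) * C ^ m"
    have K: "0 \<le> K" using C by (simp add: K_def)
    have Bmono: "B k \<le> B k'" if "k \<le> k'" for k k'
      by (rule lift_Suc_mono_le[OF _ that]) (use A_le_B B_less_A in \<open>meson less_imp_le order_trans\<close>)
    have Amono: "A k \<le> A k'" if "k \<le> k'" for k k'
      by (rule lift_Suc_mono_le[OF _ that]) (use A_le_B B_less_A in \<open>meson less_imp_le order_trans\<close>)
    have "\<exists>M. \<forall>x\<in>{A 0..B l0}. norm (nth_deriv j f x) \<le> M" for j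
    proof -
      have "bounded (nth_deriv j f ` {A 0..B l0})"
        using continuous_on_subset[OF continuous_nth_deriv[OF f_smooth order_refl] subset_UNIV]
        by (intro compact_imp_bounded compact_continuous_image) auto
      then show ?thesis by (auto simp: bounded_iff)
    qed
    then obtain M where M: "\<And>j x. x \<in> {A 0..B l0} \<Longrightarrow> norm (nth_deriv j f x) \<le> M j" by metis
    define S where "S = K + (\<Sum>j\<le>m. \<bar>M j\<bar>)"
    have "norm (nth_deriv j f x) \<le> S * (1 + x\<^sup>2) ^ (t * m + 2)" if "j \<le> m" for j x
    proof -
      have S: "0 \<le> S" "K \<le> S" using K by (auto simp: S_def intro!: add_nonneg_nonneg sum_nonneg)
      have "M j \<le> S"
        using member_le_sum[of j "{..m}" "\<lambda>j. \<bar>M j\<bar>"] that K by (simp add: S_def)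
      obtain l U where U: "open U" "x \<in> U" "\<forall>y\<in>U. f y = G l y" using f[of x] by meson
      then have fG: "nth_deriv j f x = nth_deriv j (G l) x"
        by (intro nth_deriv_cong_open[of U]) auto
      consider "x < A 0" | "x \<in> {A 0..B l0}" | "B l0 < x" "l \<le> l0" | "B l0 < x" "l0 < l"
        by fastforce
      then show ?thesis
      proof cases
        case 1
        then have "nth_deriv j (G l) x = 0"
          using supp Amono[of 0 l] by (intro nth_deriv_eq_0[of "{..<A 0}"]) auto
        then show ?thesis using S by (simp add: fG)
      next
        case 2
        then have "norm (nth_deriv j f x) \<le> S * 1" using M[of x j] \<open>M j \<le> S\<close> by simp
        also have "\<dots> \<le> S * (1 + x\<^sup>2) ^ (t * m + 2)"
          using S by (intro mult_left_mono one_le_power) auto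
        finally show ?thesis .
      next
        case 3
        then have "nth_deriv j (G l) x = 0"
          using supp Bmono[of l l0] by (intro nth_deriv_eq_0[of "{B l0<..}"]) auto
        then show ?thesis using S by (simp add: fG)
      next
        case 4
        have "norm (nth_deriv j (G l) x) \<le> K / real (l + 1) * (1 + x\<^sup>2) ^ (t * m + 2)"
          unfolding G_def K_def using C u that l0[of l] 4 \<nu>N[of l] by (intro right) auto
        also have "\<dots> \<le> S * (1 + x\<^sup>2) ^ (t * m + 2)"
        proof (rule mult_right_mono)
          have "K / real (l + 1) \<le> K / 1" using K by (intro divide_left_mono) auto
          then show "K / real (l + 1) \<le> S" using S by simp
        qed simp
        finally show ?thesis by (simp add: fG)
      qed
    qed
    then show "\<exists>C n. \<forall>j\<le>m. \<forall>x. norm (nth_deriv j f x) \<le> C * (1 + x\<^sup>2) ^ n" by blast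
  qed (rule f_smooth)
  moreover have "\<exists>C n k0. 0 \<le> C \<and> (\<forall>k\<ge>k0. \<forall>j\<le>m. \<forall>x.
      norm (nth_deriv j (f \<circ> \<psi> ^^ \<nu> k) x - nth_deriv j (g k) x) \<le> C / real (k + 1) * (1 + x\<^sup>2) ^ n)" for m
  proof -
    obtain \<beta> C t where C: "1 \<le> C" and u: "\<And>j x n. 1 \<le> j \<Longrightarrow> j \<le> m \<Longrightarrow> \<beta> < x \<Longrightarrow> 1 \<le> n \<Longrightarrow>
        \<bar>nth_deriv j (inv (\<psi> ^^ n)) x\<bar> \<le> C * (1 + x\<^sup>2) ^ t"
      and v: "\<And>j x n. 1 \<le> j \<Longrightarrow> j \<le> m \<Longrightarrow> x < - \<beta> \<Longrightarrow> 1 \<le> n \<Longrightarrow>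
        \<bar>nth_deriv j (\<psi> ^^ n) x\<bar> \<le> C * (1 + x\<^sup>2) ^ t"
      by (rule uniform_bounds[of m]) blast
    obtain k0 where k0: "\<And>k. k0 \<le> k \<Longrightarrow> m \<le> k \<and> \<beta> \<le> R k" using large[of m \<beta>] by blast
    define K where "K = 2 ^ (m * m) * C ^ m"
    have K: "0 \<le> K" using C by (simp add: K_def)
    have "norm (nth_deriv j (f \<circ> \<psi> ^^ \<nu> k) y - nth_deriv j (g k) y) \<le> K / real (k + 1) * (1 + y\<^sup>2) ^ (t * m + 2)"
      if k: "k0 \<le> k" and "j \<le> m" for j k y
    proof -
      obtain l U where U: "open U" "(\<psi> ^^ \<nu> k) y \<in> U" "\<And>z. z \<in> U \<Longrightarrow> f z = G l z"
        "\<And>z l'. z \<in> U \<Longrightarrow> l' \<noteq> l \<Longrightarrow> G l' z = 0" using f[of "(\<psi> ^^ \<nu> k) y"] by blast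
      let ?V = "(\<psi> ^^ \<nu> k) -` U"
      have V: "open ?V" "y \<in> ?V" using U by (auto intro: open_iter_vimage)
      have gk: "g k z = G k ((\<psi> ^^ \<nu> k) z)" for z by (simp add: G_def)
      have fl: "nth_deriv j (f \<circ> \<psi> ^^ \<nu> k) y = nth_deriv j h y" if "\<And>z. G l ((\<psi> ^^ \<nu> k) z) = h z" for h
        using that U(3) by (intro nth_deriv_cong_open[OF V]) auto
      \<comment> \<open>If another bump is active near the image of \<open>y\<close>, then
        \<open>G k\<close> vanishes there, so its pullback \<open>g k\<close> vanishes near
        \<open>y\<close> and the whole difference is the other bump.\<close>
      have g0: "nth_deriv j (g k) y = 0" if "l \<noteq> k"
        using that U(4) gk by (intro nth_deriv_eq_0[OF V]) auto
      consider "l = k" | "k < l" | "l < k" by linarith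
      then show ?thesis
      proof cases
        case 1
        then show ?thesis using fl[of "g k"] gk K by simp
      next
        case 2
        obtain d where d: "\<nu> l = \<nu> k + d" "N l \<le> d" using gap[OF 2] by blast
        have "inv (\<psi> ^^ \<nu> l) ((\<psi> ^^ \<nu> k) z) = inv (\<psi> ^^ d) z" for z
        proof -
          have "(\<psi> ^^ \<nu> k) z = (\<psi> ^^ \<nu> l) (inv (\<psi> ^^ d) z)" by (simp add: d(1) funpow_add)
          then show ?thesis by simp
        qed
        then have "nth_deriv j (f \<circ> \<psi> ^^ \<nu> k) y = nth_deriv j (g l \<circ> inv (\<psi> ^^ d)) y"
          by (intro fl) (simp add: G_def)
        moreover have "norm (nth_deriv j (g l \<circ> inv (\<psi> ^^ d)) y) \<le> K / real (l + 1) * (1 + y\<^sup>2) ^ (t * m + 2)"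
          unfolding K_def using C u \<open>j \<le> m\<close> k0[of l] k 2 d(2) by (intro right) auto
        moreover have "K / real (l + 1) * (1 + y\<^sup>2) ^ (t * m + 2) \<le> K / real (k + 1) * (1 + y\<^sup>2) ^ (t * m + 2)"
          using K 2 by (intro mult_right_mono divide_left_mono) auto
        ultimately show ?thesis using g0 2 by simp
      next
        case 3
        obtain d where d: "\<nu> k = \<nu> l + d" "N k \<le> d" using gap[OF 3] by blast
        have "inv (\<psi> ^^ \<nu> l) ((\<psi> ^^ \<nu> k) z) = (\<psi> ^^ d) z" for z
          by (simp add: d(1) funpow_add)
        then have "nth_deriv j (f \<circ> \<psi> ^^ \<nu> k) y = nth_deriv j (g l \<circ> \<psi> ^^ d) y"
          by (intro fl) (simp add: G_def)
        moreover have "norm (nth_deriv j (g l \<circ> \<psi> ^^ d) y) \<le> K / real (k + 1) * (1 + y\<^sup>2) ^ (t * m + 2)"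
          unfolding K_def using C v \<open>j \<le> m\<close> k0[of k] k 3 d(2) by (intro left) auto
        ultimately show ?thesis using g0 3 by simp
      qed
    qed
    then show ?thesis using K by blast
  qed
  ultimately show thesis by (rule that)
qed

end

section \<open>Sequential density of the orbit\<close>

theorem theorem3:
  fixes \<psi> :: "real \<Rightarrow> real"
  assumes "\<psi> \<in> OM"
    and "bij \<psi>"
    and "\<And>x. \<psi> x > x"
    and "\<And>x. deriv \<psi> x > 0"
    and "\<forall>j\<ge>1. \<exists>\<beta>::real. \<exists>C>0. \<exists>t::nat. t \<ge> 1 \<and>
           (\<forall>x\<in>{\<beta><..}. \<forall>n\<ge>1. \<bar>nth_deriv j (inv (\<psi> ^^ n)) x\<bar> \<le> C * (1 + \<bar>x\<bar>\<^sup>2) ^ t)"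
    and "\<forall>j\<ge>1. \<exists>\<alpha>::real. \<exists>C>0. \<exists>t::nat. t \<ge> 1 \<and>
           (\<forall>x\<in>{..<\<alpha>}. \<forall>n\<ge>1. \<bar>nth_deriv j (\<psi> ^^ n) x\<bar> \<le> C * (1 + \<bar>x\<bar>\<^sup>2) ^ t)"
  shows "sequentially_hypercyclic OM_topology (comp_op \<psi>)"
proof -
  interpret hypercyclic_flow \<psi>
    using assms OM_imp_Cm by unfold_locales blast+
  obtain g :: "nat \<Rightarrow> real \<Rightarrow> complex" where g: "\<And>k m. g k \<in> Cm m"
    "\<And>k. \<exists>r. \<forall>x. r < \<bar>x\<bar> \<longrightarrow> g k x = 0"
    "\<And>h. h \<in> OM \<Longrightarrow> \<exists>\<kappa>. (\<forall>i. i \<le> \<kappa> i) \<and> (\<forall>m. \<exists>C n. \<forall>i\<ge>m. \<forall>j\<le>m. \<forall>x.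
      norm (nth_deriv j (g (\<kappa> i)) x - nth_deriv j h x) \<le> C / real (i + 1) * (1 + x\<^sup>2) ^ n)"
    by (rule approximating_sequence) blast
  obtain f \<nu> where f: "f \<in> OM" and f_near: "\<And>m. \<exists>C n k0. 0 \<le> C \<and> (\<forall>k\<ge>k0. \<forall>j\<le>m. \<forall>x.
      norm (nth_deriv j (f \<circ> \<psi> ^^ \<nu> k) x - nth_deriv j (g k) x) \<le> C / real (k + 1) * (1 + x\<^sup>2) ^ n)"
    using g(1,2) by (rule hypercyclic_vector[of g]) blast
  have iterate: "(comp_op \<psi> ^^ n) f = f \<circ> \<psi> ^^ n" for n
    by (induction n) (simp_all add: comp_op_def funpow_swap1 fun_eq_iff)
  have "comp_op \<psi> h \<in> OM" if "h \<in> OM" for h :: "real \<Rightarrow> complex"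
    unfolding comp_op_def using assms(1) that by (rule comp_OM)
  then have iterate_OM: "(comp_op \<psi> ^^ n) f \<in> OM" for n
    using f by (induction n) auto
  have "\<exists>s. range s \<subseteq> range (\<lambda>n. (comp_op \<psi> ^^ n) f) \<and> limitin OM_topology s h sequentially"
    if h: "h \<in> OM" for h
  proof -
    obtain \<kappa> where \<kappa>: "\<And>i. i \<le> \<kappa> i" and near: "\<And>m. \<exists>C n. \<forall>i\<ge>m. \<forall>j\<le>m. \<forall>x.
      norm (nth_deriv j (g (\<kappa> i)) x - nth_deriv j h x) \<le> C / real (i + 1) * (1 + x\<^sup>2) ^ n"
      using g(3)[OF h] by blast
    define s where "s i = (comp_op \<psi> ^^ \<nu> (\<kappa> i)) f" for i
    have "limitin OM_topology s h sequentially"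
    proof (rule limitin_OM_topology)
      show "s i \<in> OM" for i by (simp add: s_def iterate_OM)
      fix m
      obtain C1 n1 k0 where 1: "0 \<le> C1" "\<And>k j x. k0 \<le> k \<Longrightarrow> j \<le> m \<Longrightarrow>
          norm (nth_deriv j (f \<circ> \<psi> ^^ \<nu> k) x - nth_deriv j (g k) x) \<le> C1 / real (k + 1) * (1 + x\<^sup>2) ^ n1"
        using f_near[of m] by blast
      obtain C2 n2 where 2: "\<And>i j x. m \<le> i \<Longrightarrow> j \<le> m \<Longrightarrow>
          norm (nth_deriv j (g (\<kappa> i)) x - nth_deriv j h x) \<le> C2 / real (i + 1) * (1 + x\<^sup>2) ^ n2"
        using near[of m] by blast
      \<comment> \<open>The approximation property does not record a sign; evaluation at x = 0,
        where the weight is 1, supplies it.\<close>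
      have C2: "0 \<le> C2"
        using order_trans[OF norm_ge_zero 2[of m 0 0]] by (simp add: zero_le_divide_iff)
      have "norm (nth_deriv j (s i) x - nth_deriv j h x)
          \<le> (C1 + C2) / real (i + 1) * (1 + x\<^sup>2) ^ (n1 + n2)" if "max k0 m \<le> i" "j \<le> m" for i j x
      proof -
        have "norm (nth_deriv j (s i) x - nth_deriv j (g (\<kappa> i)) x) \<le> C1 / real (\<kappa> i + 1) * (1 + x\<^sup>2) ^ n1"
          unfolding s_def iterate using that \<kappa>[of i] by (intro 1(2)) auto
        \<comment> \<open>Here i <= \<kappa> i turns the rate in the index of \<open>g\<close> into
          a rate in \<open>i\<close>; both errors are moved to the common exponent n1 + n2, hence to
          one step.\<close>
        also have "\<dots> \<le> C1 / real (i + 1) * (1 + x\<^sup>2) ^ (n1 + n2)"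
          using 1(1) \<kappa>[of i] by (intro mult_mono divide_left_mono weight_power_mono) auto
        finally have a: "norm (nth_deriv j (s i) x - nth_deriv j (g (\<kappa> i)) x)
            \<le> C1 / real (i + 1) * (1 + x\<^sup>2) ^ (n1 + n2)" .
        have "norm (nth_deriv j (g (\<kappa> i)) x - nth_deriv j h x) \<le> C2 / real (i + 1) * (1 + x\<^sup>2) ^ n2"
          using that by (intro 2) auto
        also have "\<dots> \<le> C2 / real (i + 1) * (1 + x\<^sup>2) ^ (n1 + n2)"
          using C2 by (intro mult_left_mono weight_power_mono) auto
        finally show ?thesis
          using a norm_diff_triangle_le by (fastforce simp: add_divide_distrib distrib_right)
      qed
      moreover have "(\<lambda>i. (C1 + C2) / real (i + 1)) \<longlonglongrightarrow> 0"
        using LIMSEQ_Suc[OF lim_const_over_n] by simp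
      ultimately show "\<exists>n \<epsilon>. \<epsilon> \<longlonglongrightarrow> 0 \<and> (\<forall>\<^sub>F i in sequentially. \<forall>j\<le>m. \<forall>x.
          norm (nth_deriv j (s i) x - nth_deriv j h x) \<le> \<epsilon> i * (1 + x\<^sup>2) ^ n)"
        unfolding eventually_sequentially by blast
    qed (rule h)
    moreover have "range s \<subseteq> range (\<lambda>n. (comp_op \<psi> ^^ n) f)" by (auto simp: s_def)
    ultimately show ?thesis by blast
  qed
  then show ?thesis
    unfolding sequentially_hypercyclic_def topspace_OM_topology
    using continuous_map_comp_OM[OF assms(1)] f
    by (auto simp: linear_op_on_def comp_op_def)
qed

end
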